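(* Let $\mathcal{T}\subset\mathbb{R}^d$ be a Borel set and let $y(t)=\theta^\top f(t)+\epsilon(t)$ be a random field on a subset of $\mathbb{R}^d$ containing $\mathcal{T}\cup\mathcal{S}$, where $f$ is a known $\mathbb{R}^m$-valued function, $\theta\in\mathbb{R}^m$ is unknown, and $\epsilon$ is a zero-mean random field with covariance kernel $K(t,s)=\mathbb{E}[\epsilon(t)\epsilon(s)]$, subject to the standing assumptions in the context. Let $\nu$ be a signed measure on the Borel field of $\mathbb{R}^d$ with support $\mathcal{S}$, where $\mathcal{S}\setminus\mathcal{T}\neq\emptyset$, and let $Z=\int_{\mathcal{S}}y(t)\,\nu(dt)$. Assume that the best linear unbiased estimator (BLUE) $\hat\theta_{\mathrm{BLUE}}=\int_{\mathcal{T}}y(t)\,G(dt)$ of $\theta$ exists ($G$ a signed $\mathbb{R}^m$-valued measure on $\mathcal{T}$), let $D$ be its covariance matrix, and assume that there exists a signed measure $\zeta_\nu$ on $\mathcal{T}$ such that $$\int_{\mathcal{T}}K(t,s)\,\zeta_\nu(dt)=\int_{\mathcal{S}}K(s,u)\,\nu(du)\qquad\text{for all } s\in\mathcal{T}.$$ Then the BLUP measure $Q_*$ for predicting $Z$ exists and is given by $$Q_*(dt)=\zeta_\nu(dt)+c^\top G(dt),\qquad c=\int_{\mathcal{S}}f(s)\,\nu(ds)-\int_{\mathcal{T}}f(t)\,\zeta_\nu(dt).$$ The mean squared error of the BLUP $\hat Z_{Q_*}=\int_{\mathcal{T}}y(t)\,Q_*(dt)$ is $$\mathrm{MSE}(\hat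 Z_{Q_*})=\int_{\mathcal{S}}\int_{\mathcal{S}}K(s,u)\,\nu(ds)\,\nu(du)+c^\top D\int_{\mathcal{S}}f(s)\,\nu(ds)-\int_{\mathcal{S}}\int_{\mathcal{T}}K(t,u)\,\nu(du)\,Q_*(dt).$$
   Context: Standing assumptions: the components of $f$ are bounded, integrable and linearly independent as functions on $\mathcal{T}$; the kernel $K$ is strictly positive definite. The field $y$ is observed at all $t\in\mathcal{T}$. Convention on integrals: signed measures (including $\nu$) are finite signed Borel measures for which the integrals of $f$ and the double integrals of $K$ that occur converge absolutely; the stochastic integral $\int y\,dQ$ is a random variable with mean $\theta^\top\int f\,dQ$, and the covariance of $\int\epsilon\,dQ_1$ and $\int\epsilon\,dQ_2$ is $\iint K(t,s)\,Q_1(dt)\,Q_2(ds)$. Finite combinations of point masses are admissible. Linear predictors of $Z$: for a signed measure $Q$ on $\mathcal{T}$, $\hat Z_Q=\int_{\mathcal{T}}y(t)\,Q(dt)$. It is unbiased if and only if $\int_{\mathcal{T}}f(t)\,Q(dt)=\int_{\mathcal{S}}f(s)\,\nu(ds)$. Its mean squared error is $\mathrm{MSE}(\hat Z_Q)=\mathbb{E}(Z-\hat Z_Q)^2$. A BLUP measure is a signed measure $Q_*$ on $\mathcal{T}$ that satisfies the unbiasedness condition and minimizes $\mathrm{MSE}(\hat Z_Q)$ among all signed measures $Q$ satisfying it; $\hat Z_{Q_*}$ is the best linear unbiased predictor (BLUP). BLUE: a linear estimator $\int_{\mathcal{T}}y(t)\,G(dt)$, with $G$ a signed $\mathbb{R}^m$-valued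 measure on $\mathcal{T}$, is unbiased for $\theta$ if $\int_{\mathcal{T}}f(t)\,G^\top(dt)=I_m$; it is the BLUE if it is unbiased and its covariance matrix is minimal in the Loewner order among all linear unbiased estimators. It is known that this holds if and only if $\int_{\mathcal{T}}f(t)\,G^\top(dt)=I_m$ and $\int_{\mathcal{T}}K(t,s)\,G(dt)=Df(s)$ for all $s\in\mathcal{T}$ and some $m\times m$ matrix $D$; then $D$ is the covariance matrix of the BLUE (possibly degenerate). *)

theory Defs
  imports "HOL-Probability.Probability"
begin

text \<open>
  Finite signed Borel measures are represented as real-valued set functions; only their values on
  Borel sets matter. A vector-valued measure is a vector-valued set function all of whose
  components are signed measures.
\<close>

definition signed_measure :: "('a::topological_space set \<Rightarrow> real) \<Rightarrow> bool" where
  "signed_measure \<mu> \<longleftrightarrow> \<mu> {} = 0 \<and>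
     (\<forall>A :: nat \<Rightarrow> 'a set. range A \<subseteq> sets borel \<longrightarrow> disjoint_family A \<longrightarrow>
        (\<lambda>n. \<mu> (A n)) sums \<mu> (\<Union>n. A n))"

definition concentrated_on :: "('a::topological_space set \<Rightarrow> real) \<Rightarrow> 'a set \<Rightarrow> bool" where
  "concentrated_on \<mu> A \<longleftrightarrow> (\<forall>B\<in>sets borel. B \<inter> A = {} \<longrightarrow> \<mu> B = 0)"

text \<open>The topological support, i.e. the complement of the largest open null set of the total
  variation.\<close>

definition signed_support :: "('a::topological_space set \<Rightarrow> real) \<Rightarrow> 'a set" where
  "signed_support \<mu> =
     {x. \<forall>U. open U \<longrightarrow> x \<in> U \<longrightarrow> (\<exists>B\<in>sets borel. B \<subseteq> U \<and> \<mu> B \<noteq> 0)}"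

definition point_mass :: "'a \<Rightarrow> 'a set \<Rightarrow> real" where
  "point_mass t A = indicator A t"

text \<open>
  Jordan decomposition: the positive variation of A is the supremum of the values of the signed
  measure on Borel subsets of A. The function ennreal sends negative reals to 0, which is harmless
  because the empty set always contributes the value 0.
\<close>

definition pos_variation :: "('a::topological_space set \<Rightarrow> real) \<Rightarrow> 'a measure" where
  "pos_variation \<mu> =
     measure_of UNIV (sets borel) (\<lambda>A. SUP B\<in>{B\<in>sets borel. B \<subseteq> A}. ennreal (\<mu> B))"

definition neg_variation :: "('a::topological_space set \<Rightarrow> real) \<Rightarrow> 'a measure" where
  "neg_variation \<mu> = pos_variation (\<lambda>A. - \<mu> A)"

definition total_variation :: "('a::topological_space set \<Rightarrow> real) \<Rightarrow> 'a measure" where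
  "total_variation \<mu> =
     measure_of UNIV (sets borel)
       (\<lambda>A. emeasure (pos_variation \<mu>) A + emeasure (neg_variation \<mu>) A)"

definition signed_integrable ::
  "('a::topological_space set \<Rightarrow> real) \<Rightarrow> 'a set \<Rightarrow>
   ('a \<Rightarrow> 'b::{banach, second_countable_topology}) \<Rightarrow> bool" where
  "signed_integrable \<mu> A g \<longleftrightarrow> set_integrable (total_variation \<mu>) A g"

definition signed_integral ::
  "('a::topological_space set \<Rightarrow> real) \<Rightarrow> 'a set \<Rightarrow>
   ('a \<Rightarrow> 'b::{banach, second_countable_topology}) \<Rightarrow> 'b" where
  "signed_integral \<mu> A g =
     set_lebesgue_integral (pos_variation \<mu>) A g - set_lebesgue_integral (neg_variation \<mu>) A g"

text \<open>Absolute convergence and value of the double integral of \<open>K t s\<close> over \<open>t \<in> A\<close> (with respect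
  to \<open>\<mu>\<close>) and \<open>s \<in> B\<close> (with respect to \<open>\<rho>\<close>).\<close>

definition kernel_integrable ::
  "('a::topological_space \<Rightarrow> 'a \<Rightarrow> real) \<Rightarrow> 'a set \<Rightarrow> ('a set \<Rightarrow> real) \<Rightarrow>
   'a set \<Rightarrow> ('a set \<Rightarrow> real) \<Rightarrow> bool" where
  "kernel_integrable K A \<mu> B \<rho> \<longleftrightarrow>
     set_integrable (total_variation \<mu> \<Otimes>\<^sub>M total_variation \<rho>) (A \<times> B) (\<lambda>(t, s). K t s)"

definition kernel_integral ::
  "('a::topological_space \<Rightarrow> 'a \<Rightarrow> real) \<Rightarrow> 'a set \<Rightarrow> ('a set \<Rightarrow> real) \<Rightarrow>
   'a set \<Rightarrow> ('a set \<Rightarrow> real) \<Rightarrow> real" where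
  "kernel_integral K A \<mu> B \<rho> = signed_integral \<mu> A (\<lambda>t. signed_integral \<rho> B (\<lambda>s. K t s))"

definition strictly_positive_definite_on :: "'a set \<Rightarrow> ('a \<Rightarrow> 'a \<Rightarrow> real) \<Rightarrow> bool" where
  "strictly_positive_definite_on E K \<longleftrightarrow>
     (\<forall>F (a :: 'a \<Rightarrow> real). finite F \<longrightarrow> F \<subseteq> E \<longrightarrow> (\<exists>t\<in>F. a t \<noteq> 0) \<longrightarrow>
        0 < (\<Sum>t\<in>F. \<Sum>s\<in>F. a t * a s * K t s))"

text \<open>Linear independence of the components of \<open>f\<close> as functions on \<open>T\<close>.\<close>

definition components_independent_on :: "'a set \<Rightarrow> ('a \<Rightarrow> real ^ 'm) \<Rightarrow> bool" where
  "components_independent_on T f \<longleftrightarrow>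
     (\<forall>a :: real ^ 'm. (\<forall>t\<in>T. (\<Sum>i\<in>UNIV. a $ i * f t $ i) = 0) \<longrightarrow> a = 0)"

definition centered_random_field ::
  "'w measure \<Rightarrow> 'a set \<Rightarrow> ('a \<Rightarrow> 'w \<Rightarrow> real) \<Rightarrow> ('a \<Rightarrow> 'a \<Rightarrow> real) \<Rightarrow> bool" where
  "centered_random_field M E \<epsilon> K \<longleftrightarrow>
     (\<forall>t\<in>E. \<epsilon> t \<in> borel_measurable M \<and> integrable M (\<lambda>\<omega>. (\<epsilon> t \<omega>)\<^sup>2) \<and> (LINT \<omega>|M. \<epsilon> t \<omega>) = 0) \<and>
     (\<forall>t\<in>E. \<forall>s\<in>E. K t s = (LINT \<omega>|M. \<epsilon> t \<omega> * \<epsilon> s \<omega>))"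

definition covariance :: "'w measure \<Rightarrow> ('w \<Rightarrow> real) \<Rightarrow> ('w \<Rightarrow> real) \<Rightarrow> real" where
  "covariance M X Y =
     (LINT \<omega>|M. (X \<omega> - (LINT \<omega>'|M. X \<omega>')) * (Y \<omega> - (LINT \<omega>'|M. Y \<omega>')))"

definition covariance_matrix :: "'w measure \<Rightarrow> ('w \<Rightarrow> real ^ 'm) \<Rightarrow> real ^ 'm ^ 'm" where
  "covariance_matrix M X = (\<chi> i j. covariance M (\<lambda>\<omega>. X \<omega> $ i) (\<lambda>\<omega>. X \<omega> $ j))"

text \<open>Loewner order (used for symmetric matrices only).\<close>

definition loewner_le :: "real ^ 'm ^ 'm \<Rightarrow> real ^ 'm ^ 'm \<Rightarrow> bool" where
  "loewner_le A B \<longleftrightarrow> (\<forall>x. 0 \<le> x \<bullet> ((B - A) *v x))"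

definition admissible ::
  "('a::topological_space \<Rightarrow> real ^ 'm) \<Rightarrow> ('a \<Rightarrow> 'a \<Rightarrow> real) \<Rightarrow> 'a set \<Rightarrow> ('a set \<Rightarrow> real) \<Rightarrow> bool"
  where
  "admissible f K A Q \<longleftrightarrow> signed_measure Q \<and> concentrated_on Q A \<and>
     signed_integrable Q A f \<and> kernel_integrable K A Q A Q"

text \<open>
  Stochastic integration. Pathwise integrals of the field need not exist, so the integral is an
  operator \<open>J\<close> (with \<open>J Q\<close> standing for the integral of \<open>y\<close> with respect to \<open>Q\<close>) that has the
  mean and the covariances prescribed for it and returns \<open>y t\<close> for the point mass at \<open>t\<close>.
  Linearity of \<open>J\<close>, up to null sets, follows from the first two moments.
\<close>

definition stochastic_integral ::
  "'w measure \<Rightarrow> 'a::topological_space set \<Rightarrow> (real ^ 'm) \<Rightarrow> ('a \<Rightarrow> real ^ 'm) \<Rightarrow>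
   ('a \<Rightarrow> 'a \<Rightarrow> real) \<Rightarrow> ('a \<Rightarrow> 'w \<Rightarrow> real) \<Rightarrow> (('a set \<Rightarrow> real) \<Rightarrow> 'w \<Rightarrow> real) \<Rightarrow> bool" where
  "stochastic_integral M E \<theta> f K y J \<longleftrightarrow>
     (\<forall>A\<in>sets borel. A \<subseteq> E \<longrightarrow> (\<forall>Q. admissible f K A Q \<longrightarrow>
        J Q \<in> borel_measurable M \<and> integrable M (\<lambda>\<omega>. (J Q \<omega>)\<^sup>2) \<and>
        (LINT \<omega>|M. J Q \<omega>) = \<theta> \<bullet> signed_integral Q A f)) \<and>
     (\<forall>A\<in>sets borel. \<forall>B\<in>sets borel. A \<subseteq> E \<longrightarrow> B \<subseteq> E \<longrightarrow>
        (\<forall>Q R. admissible f K A Q \<longrightarrow> admissible f K B R \<longrightarrow> kernel_integrable K A Q B R \<longrightarrow>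
           covariance M (J Q) (J R) = kernel_integral K A Q B R)) \<and>
     (\<forall>t\<in>E. AE \<omega> in M. J (point_mass t) \<omega> = y t \<omega>)"

text \<open>Prediction of \<open>J \<nu>\<close>, where \<open>\<nu>\<close> lives on \<open>S\<close>, by \<open>J Q\<close> with \<open>Q\<close> on \<open>T\<close>.\<close>

definition mse :: "'w measure \<Rightarrow> ('w \<Rightarrow> real) \<Rightarrow> ('w \<Rightarrow> real) \<Rightarrow> real" where
  "mse M Z X = (LINT \<omega>|M. (Z \<omega> - X \<omega>)\<^sup>2)"

definition predictor_measure ::
  "('a::topological_space \<Rightarrow> real ^ 'm) \<Rightarrow> ('a \<Rightarrow> 'a \<Rightarrow> real) \<Rightarrow> 'a set \<Rightarrow> 'a set \<Rightarrow>
   ('a set \<Rightarrow> real) \<Rightarrow> ('a set \<Rightarrow> real) \<Rightarrow> bool" where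
  "predictor_measure f K T S \<nu> Q \<longleftrightarrow> admissible f K T Q \<and> kernel_integrable K T Q S \<nu>"

definition unbiased_predictor ::
  "('a::topological_space \<Rightarrow> real ^ 'm) \<Rightarrow> 'a set \<Rightarrow> 'a set \<Rightarrow> ('a set \<Rightarrow> real) \<Rightarrow>
   ('a set \<Rightarrow> real) \<Rightarrow> bool" where
  "unbiased_predictor f T S \<nu> Q \<longleftrightarrow> signed_integral Q T f = signed_integral \<nu> S f"

definition is_BLUP_measure ::
  "'w measure \<Rightarrow> (('a::topological_space set \<Rightarrow> real) \<Rightarrow> 'w \<Rightarrow> real) \<Rightarrow> ('a \<Rightarrow> real ^ 'm) \<Rightarrow>
   ('a \<Rightarrow> 'a \<Rightarrow> real) \<Rightarrow> 'a set \<Rightarrow> 'a set \<Rightarrow> ('a set \<Rightarrow> real) \<Rightarrow> ('a set \<Rightarrow> real) \<Rightarrow> bool" where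
  "is_BLUP_measure M J f K T S \<nu> Q \<longleftrightarrow>
     predictor_measure f K T S \<nu> Q \<and> unbiased_predictor f T S \<nu> Q \<and>
     (\<forall>R. predictor_measure f K T S \<nu> R \<longrightarrow> unbiased_predictor f T S \<nu> R \<longrightarrow>
        mse M (J \<nu>) (J Q) \<le> mse M (J \<nu>) (J R))"

text \<open>Linear estimation of \<open>\<theta>\<close> by a vector-valued measure on \<open>T\<close>.\<close>

definition component :: "('a set \<Rightarrow> real ^ 'm) \<Rightarrow> 'm \<Rightarrow> 'a set \<Rightarrow> real" where
  "component G i = (\<lambda>A. G A $ i)"

definition linear_estimator ::
  "(('a set \<Rightarrow> real) \<Rightarrow> 'w \<Rightarrow> real) \<Rightarrow> ('a set \<Rightarrow> real ^ 'm) \<Rightarrow> 'w \<Rightarrow> real ^ 'm" where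
  "linear_estimator J G \<omega> = (\<chi> i. J (component G i) \<omega>)"

definition estimator_measure ::
  "('a::topological_space \<Rightarrow> real ^ 'm) \<Rightarrow> ('a \<Rightarrow> 'a \<Rightarrow> real) \<Rightarrow> 'a set \<Rightarrow>
   ('a set \<Rightarrow> real ^ 'm) \<Rightarrow> bool" where
  "estimator_measure f K T G \<longleftrightarrow>
     (\<forall>i. admissible f K T (component G i)) \<and>
     (\<forall>i j. kernel_integrable K T (component G i) T (component G j))"

text \<open>The matrix below has the integral of \<open>f t $ i\<close> with respect to the \<open>j\<close>-th component of \<open>G\<close>
  in row \<open>i\<close> and column \<open>j\<close>.\<close>

definition unbiased_estimator ::
  "('a::topological_space \<Rightarrow> real ^ 'm) \<Rightarrow> 'a set \<Rightarrow> ('a set \<Rightarrow> real ^ 'm) \<Rightarrow> bool" where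
  "unbiased_estimator f T G \<longleftrightarrow>
     (\<chi> i j. signed_integral (component G j) T (\<lambda>t. f t $ i)) = (mat 1 :: real ^ 'm ^ 'm)"

definition is_BLUE ::
  "'w measure \<Rightarrow> (('a::topological_space set \<Rightarrow> real) \<Rightarrow> 'w \<Rightarrow> real) \<Rightarrow> ('a \<Rightarrow> real ^ 'm) \<Rightarrow>
   ('a \<Rightarrow> 'a \<Rightarrow> real) \<Rightarrow> 'a set \<Rightarrow> ('a set \<Rightarrow> real ^ 'm) \<Rightarrow> bool" where
  "is_BLUE M J f K T G \<longleftrightarrow>
     estimator_measure f K T G \<and> unbiased_estimator f T G \<and>
     (\<forall>H. estimator_measure f K T H \<longrightarrow> unbiased_estimator f T H \<longrightarrow>
        loewner_le (covariance_matrix M (linear_estimator J H))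
                   (covariance_matrix M (linear_estimator J G)) \<longrightarrow>
        covariance_matrix M (linear_estimator J H) = covariance_matrix M (linear_estimator J G))"

end

theory Submission
  imports Defs
begin

text \<open>
  Two extremal conditions drive the argument. Perturbing the BLUE \<open>G\<close> by a measure \<open>\<eta>\<close> with
  \<open>\<integral>f d\<eta> = 0\<close> shows that \<open>\<integral>y dG\<close> is uncorrelated with \<open>\<integral>y d\<eta>\<close>; taking for \<open>\<eta>\<close> finite
  combinations of point masses, the potential \<open>\<integral>K(t, s) G(dt)\<close> depends linearly on \<open>f s\<close> for
  \<open>s \<in> T\<close>, and integrating against \<open>G\<close> identifies the linear map as \<open>D\<close>. Hence the potential of
  \<open>Qstar\<close> on \<open>T\<close> is that of \<open>\<nu>\<close> plus \<open>c \<bullet> D f\<close>, so for unbiased predictors \<open>R\<close> the covariance of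
  \<open>J R - J Qstar\<close> with \<open>J \<nu> - J Qstar\<close> vanishes and Pythagoras gives minimality.

  On the measure-theoretic side, every finite family of signed measures has densities with respect
  to one finite measure, which turns all integrals into Bochner integrals of products.
\<close>

section \<open>Finite signed measures and their densities\<close>

text \<open>\<open>is_BLUE\<close> states minimality in a partial order, so a competitor says
  something about \<open>G\<close> only when its covariance matrix lies below that of
  \<open>G\<close>. The perturbation therefore subtracts from each component of \<open>G\<close> its
  own regression on \<eta>, which lowers the covariance matrix by a positive semidefinite matrix of
  rank at most one. Point masses suffice as test measures because finitely many values of
  \<open>f\<close> span all the others: a potential that respects every linear relation among the
  values of \<open>f\<close> is a linear function of them.

  The second obstacle is integrability. A competing predictor \<open>R\<close> is known to have
  convergent double integrals with itself and with \<nu>, but not with \<open>Qstar\<close>, so the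
  covariance of \<open>J R\<close> and \<open>J Qstar\<close> is not covered by the rules for
  \<open>J\<close> and has to be reached as a limit.

  Finally, the variations are defined as suprema over Borel subsets, so their additivity and
  finiteness must be proved before any density exists.\<close>

lemma signed_measure_empty: "signed_measure \<mu> \<Longrightarrow> \<mu> {} = 0"
  by (simp add: signed_measure_def)

lemma signed_measure_sums:
  assumes "signed_measure \<mu>" "\<And>n. A n \<in> sets borel" "disjoint_family A"
  shows "(\<lambda>n. \<mu> (A n)) sums \<mu> (\<Union>n. A n)"
  using assms by (auto simp: signed_measure_def)

lemma signed_measure_Un:
  assumes "signed_measure \<mu>" "A \<in> sets borel" "B \<in> sets borel" "A \<inter> B = {}"
  shows "\<mu> (A \<union> B) = \<mu> A + \<mu> B"
proof -
  have "(\<lambda>n. \<mu> (binaryset A B n)) sums \<mu> (\<Union>n. binaryset A B n)"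
    using assms by (intro signed_measure_sums) (auto simp: disjoint_family_on_def binaryset_def)
  moreover have "(\<lambda>n. \<mu> (binaryset A B n)) sums (\<mu> A + \<mu> B)"
    using assms by (intro binaryset_sums) (simp add: signed_measure_empty)
  ultimately show ?thesis
    by (metis UN_binaryset_eq sums_unique2)
qed

lemma signed_measure_Diff:
  assumes "signed_measure \<mu>" "A \<in> sets borel" "B \<in> sets borel" "B \<subseteq> A"
  shows "\<mu> (A - B) = \<mu> A - \<mu> B"
  using signed_measure_Un[of \<mu> "A - B" B] assms
  by (simp add: Un_absorb2 Diff_disjoint Int_commute)

lemma signed_measure_uminus: "signed_measure \<mu> \<Longrightarrow> signed_measure (\<lambda>A. - \<mu> A)"
  by (auto simp: signed_measure_def intro!: sums_minus)

section \<open>Positive variation and Jordan decomposition\<close>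

definition pos_var :: "('a::topological_space set \<Rightarrow> real) \<Rightarrow> 'a set \<Rightarrow> ennreal" where
  "pos_var \<mu> A = (SUP B\<in>{B\<in>sets borel. B \<subseteq> A}. ennreal (\<mu> B))"

lemma pos_var_upper: "B \<in> sets borel \<Longrightarrow> B \<subseteq> A \<Longrightarrow> ennreal (\<mu> B) \<le> pos_var \<mu> A"
  unfolding pos_var_def by (rule SUP_upper) auto

lemma pos_var_least: "(\<And>B. B \<in> sets borel \<Longrightarrow> B \<subseteq> A \<Longrightarrow> ennreal (\<mu> B) \<le> x) \<Longrightarrow> pos_var \<mu> A \<le> x"
  unfolding pos_var_def by (rule SUP_least) auto

lemma pos_var_mono: "A \<subseteq> B \<Longrightarrow> pos_var \<mu> A \<le> pos_var \<mu> B"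
  by (rule pos_var_least) (auto intro!: pos_var_upper)

lemma pos_var_empty: "signed_measure \<mu> \<Longrightarrow> pos_var \<mu> {} = 0"
  by (auto intro!: antisym pos_var_least simp: signed_measure_empty)

lemma pos_var_Un_ge:
  assumes \<mu>: "signed_measure \<mu>" and "A \<inter> B = {}"
  shows "pos_var \<mu> A + pos_var \<mu> B \<le> pos_var \<mu> (A \<union> B)"
proof -
  have "ennreal (\<mu> C) + ennreal (\<mu> D) \<le> pos_var \<mu> (A \<union> B)"
    if "C \<in> sets borel" "C \<subseteq> A" "D \<in> sets borel" "D \<subseteq> B" for C D
  proof -
    \<comment> \<open>\<open>ennreal\<close> cuts negative values to 0. If one value is not
      positive, the other set alone bounds the sum; only two nonnegative values call for the
      union.\<close>
    consider "\<mu> C \<le> 0" | "\<mu> D \<le> 0" | "0 \<le> \<mu> C" "0 \<le> \<mu> D" by linarith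
    then show ?thesis
    proof cases
      case 1
      then show ?thesis using that by (auto simp: ennreal_neg intro!: pos_var_upper)
    next
      case 2
      then show ?thesis using that by (auto simp: ennreal_neg intro!: pos_var_upper)
    next
      case 3
      have "\<mu> (C \<union> D) = \<mu> C + \<mu> D"
        using that assms by (intro signed_measure_Un) auto
      then have "ennreal (\<mu> C) + ennreal (\<mu> D) = ennreal (\<mu> (C \<union> D))"
        using 3 by simp
      also have "\<dots> \<le> pos_var \<mu> (A \<union> B)"
        using that by (intro pos_var_upper) auto
      finally show ?thesis .
    qed
  qed
  then have *: "ennreal (\<mu> D) + ennreal (\<mu> C) \<le> pos_var \<mu> (A \<union> B)"
    if "C \<in> sets borel" "C \<subseteq> A" "D \<in> sets borel" "D \<subseteq> B" for C D
    using that by (simp only: add.commute)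
  have "pos_var \<mu> B + ennreal (\<mu> C) \<le> pos_var \<mu> (A \<union> B)" if "C \<in> sets borel" "C \<subseteq> A" for C
    unfolding pos_var_def[of \<mu> B] using that *
    by (subst ennreal_SUP_add_left[symmetric]) (auto intro!: SUP_least)
  then have "ennreal (\<mu> C) + pos_var \<mu> B \<le> pos_var \<mu> (A \<union> B)" if "C \<in> sets borel" "C \<subseteq> A" for C
    using that by (simp only: add.commute)
  then show ?thesis
    unfolding pos_var_def[of \<mu> A]
    by (subst ennreal_SUP_add_left[symmetric]) (auto intro!: SUP_least)
qed

lemma pos_var_countable_le:
  assumes \<mu>: "signed_measure \<mu>" and A: "\<And>n. A n \<in> sets borel" "disjoint_family A"
  shows "pos_var \<mu> (\<Union>n. A n) \<le> (\<Sum>n. pos_var \<mu> (A n))"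
proof (rule pos_var_least)
  fix B assume B: "B \<in> sets borel" "B \<subseteq> (\<Union>n. A n)"
  have "(\<lambda>n. \<mu> (B \<inter> A n)) sums \<mu> (\<Union>n. B \<inter> A n)"
    using A B by (intro signed_measure_sums \<mu>) (auto simp: disjoint_family_on_def)
  moreover have "(\<Union>n. B \<inter> A n) = B" using B by auto
  ultimately have "(\<lambda>N. \<Sum>n<N. \<mu> (B \<inter> A n)) \<longlonglongrightarrow> \<mu> B" by (simp add: sums_def)
  then have "(\<lambda>N. ennreal (\<Sum>n<N. \<mu> (B \<inter> A n))) \<longlonglongrightarrow> ennreal (\<mu> B)"
    by (rule tendsto_ennrealI)
  then show "ennreal (\<mu> B) \<le> (\<Sum>n. pos_var \<mu> (A n))"
  proof (rule LIMSEQ_le_const2, intro exI allI impI)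
    fix N
    \<comment> \<open>\<open>ennreal\<close> is not additive on terms of mixed sign, so each term is
      first replaced by its positive part.\<close>
    have "ennreal (\<Sum>n<N. \<mu> (B \<inter> A n)) \<le> ennreal (\<Sum>n<N. max 0 (\<mu> (B \<inter> A n)))"
      by (intro ennreal_leI sum_mono) auto
    also have "\<dots> = (\<Sum>n<N. ennreal (\<mu> (B \<inter> A n)))"
      by (subst sum_ennreal[symmetric], simp, intro sum.cong refl) (auto simp: max_def ennreal_neg)
    also have "\<dots> \<le> (\<Sum>n<N. pos_var \<mu> (A n))"
      using A B by (intro sum_mono pos_var_upper) auto
    also have "\<dots> \<le> (\<Sum>n. pos_var \<mu> (A n))"
      by (rule sum_le_suminf) auto
    finally show "ennreal (\<Sum>n<N. \<mu> (B \<inter> A n)) \<le> (\<Sum>n. pos_var \<mu> (A n))" .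
  qed
qed

lemma pos_var_countable_ge:
  assumes \<mu>: "signed_measure \<mu>" and A: "disjoint_family A"
  shows "(\<Sum>n. pos_var \<mu> (A n)) \<le> pos_var \<mu> (\<Union>n. A n)"
proof (rule suminf_le_const[OF summableI])
  fix N
  have "(\<Sum>n<N. pos_var \<mu> (A n)) \<le> pos_var \<mu> (\<Union>n<N. A n)"
  proof (induction N)
    case (Suc N)
    have "A n \<inter> A N = {}" if "n < N" for n
      using disjoint_family_onD[OF A, of n N] that by auto
    then have "(\<Union>n<N. A n) \<inter> A N = {}" by auto
    note pos_var_Un_ge[OF \<mu> this]
    moreover have "(\<Union>n<N. A n) \<union> A N = (\<Union>n<Suc N. A n)"
      by (auto simp: less_Suc_eq)
    ultimately show ?case
      using add_right_mono[OF Suc, of "pos_var \<mu> (A N)"]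
      by (simp only: sum.lessThan_Suc order_trans)
  qed (simp add: pos_var_empty[OF \<mu>])
  also have "\<dots> \<le> pos_var \<mu> (\<Union>n. A n)" by (rule pos_var_mono) auto
  finally show "(\<Sum>n<N. pos_var \<mu> (A n)) \<le> pos_var \<mu> (\<Union>n. A n)" .
qed

text \<open>\<open>measure_of\<close> returns the given set function only once that function is
  known to be countably additive. Joining subsets of disjoint pieces gives one inequality, cutting a
  subset of the union along the pieces gives the other.\<close>

lemma emeasure_pos_variation:
  assumes "signed_measure \<mu>" "A \<in> sets borel"
  shows "emeasure (pos_variation \<mu>) A = pos_var \<mu> A"
proof (rule emeasure_measure_of)
  show "pos_variation \<mu> = measure_of UNIV (sets borel) (pos_var \<mu>)"
    unfolding pos_variation_def pos_var_def ..
  show "positive (sets (pos_variation \<mu>)) (pos_var \<mu>)"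
    using assms by (simp add: positive_def pos_var_empty)
  have "sets (pos_variation \<mu>) = sets borel"
    using sets.sigma_sets_eq[of borel] by (simp add: pos_variation_def sets_measure_of_conv)
  then show "A \<in> sets (pos_variation \<mu>)"
    and "countably_additive (sets (pos_variation \<mu>)) (pos_var \<mu>)"
    using assms
    by (auto simp: countably_additive_def intro!: antisym pos_var_countable_le pos_var_countable_ge)
qed auto

lemma sets_pos_variation [simp]: "sets (pos_variation \<mu>) = sets borel"
  using sets.sigma_sets_eq[of borel] by (simp add: pos_variation_def sets_measure_of_conv)

text \<open>If the positive variation of \<open>E\<close> is infinite, then \<open>E\<close> splits into two parts on both of
  which \<open>\<mu>\<close> exceeds 1 in absolute value, and one part again has infinite positive variation.\<close>

lemma pos_var_infinite_split:
  assumes \<mu>: "signed_measure \<mu>" and E: "E \<in> sets borel" "pos_var \<mu> E = \<infinity>"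
  shows "\<exists>F\<in>sets borel. F \<subseteq> E \<and> pos_var \<mu> F = \<infinity> \<and> 1 < \<bar>\<mu> (E - F)\<bar>"
proof -
  \<comment> \<open>The threshold 1 + |\<mu> E| serves both parts: \<mu> A exceeds 1, and \<mu> (E -
    A) = \<mu> E - \<mu> A lies below -1.\<close>
  have "\<exists>A\<in>sets borel. A \<subseteq> E \<and> 1 + \<bar>\<mu> E\<bar> < \<mu> A"
  proof (rule ccontr)
    assume "\<not> ?thesis"
    then have "pos_var \<mu> E \<le> ennreal (1 + \<bar>\<mu> E\<bar>)"
      by (intro pos_var_least ennreal_leI) (auto simp: not_less)
    with E show False by (auto simp: top_unique)
  qed
  then obtain A where A: "A \<in> sets borel" "A \<subseteq> E" "1 + \<bar>\<mu> E\<bar> < \<mu> A" by blast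
  have diff: "\<mu> (E - A) = \<mu> E - \<mu> A"
    using A E \<mu> by (intro signed_measure_Diff) auto
  have "pos_var \<mu> E \<le> pos_var \<mu> A + pos_var \<mu> (E - A)"
  proof (rule pos_var_least)
    fix B assume B: "B \<in> sets borel" "B \<subseteq> E"
    have "\<mu> B = \<mu> (B \<inter> A) + \<mu> (B - A)"
      using signed_measure_Un[OF \<mu>, of "B \<inter> A" "B - A"] A B
      by (auto simp: Int_Diff_Un)
    then have "ennreal (\<mu> B) \<le> ennreal (\<mu> (B \<inter> A)) + ennreal (\<mu> (B - A))"
      by (cases "0 \<le> \<mu> (B \<inter> A)"; cases "0 \<le> \<mu> (B - A)")
        (auto simp: ennreal_neg simp flip: ennreal_plus intro!: ennreal_leI)
    also have "\<dots> \<le> pos_var \<mu> A + pos_var \<mu> (E - A)"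
      using A B by (intro add_mono pos_var_upper) auto
    finally show "ennreal (\<mu> B) \<le> pos_var \<mu> A + pos_var \<mu> (E - A)" .
  qed
  then have "pos_var \<mu> A = \<infinity> \<or> pos_var \<mu> (E - A) = \<infinity>"
    using E by (auto simp: top_unique)
  then show ?thesis
  proof
    assume "pos_var \<mu> A = \<infinity>"
    then show ?thesis using A diff by (intro bexI[of _ A]) auto
  next
    assume *: "pos_var \<mu> (E - A) = \<infinity>"
    have "E - (E - A) = A" using A by auto
    then show ?thesis using * A E by (intro bexI[of _ "E - A"]) auto
  qed
qed

text \<open>Otherwise repeated splitting produces a decreasing sequence of sets with infinite
  positive variation. The successive differences are disjoint and have measure above 1 in absolute
  value, so the series of their measures cannot converge.\<close>

lemma pos_var_finite:
  assumes \<mu>: "signed_measure \<mu>"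
  shows "pos_var \<mu> UNIV \<noteq> \<infinity>"
proof
  assume inf: "pos_var \<mu> UNIV = \<infinity>"
  define P where "P n E \<longleftrightarrow> E \<in> sets borel \<and> pos_var \<mu> E = \<infinity>" for n :: nat and E
  have "\<exists>E. \<forall>n. P n (E n) \<and> E (Suc n) \<subseteq> E n \<and> 1 < \<bar>\<mu> (E n - E (Suc n))\<bar>"
    using pos_var_infinite_split[OF \<mu>] inf
    by (intro dependent_nat_choice) (auto simp: P_def)
  then obtain E where E: "\<And>n. E n \<in> sets borel" "\<And>n. E (Suc n) \<subseteq> E n"
    "\<And>n. 1 < \<bar>\<mu> (E n - E (Suc n))\<bar>"
    by (auto simp: P_def)
  have dec: "decseq E" using E(2) by (rule decseq_SucI)
  have "disjoint_family (\<lambda>n. E n - E (Suc n))"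
  proof -
    have "(E m - E (Suc m)) \<inter> (E n - E (Suc n)) = {}" if "m < n" for m n
      using decseqD[OF dec, of "Suc m" n] that by auto
    then show ?thesis
      by (auto simp: disjoint_family_on_def) (metis DiffI IntI empty_iff linorder_neqE_nat)
  qed
  then have "(\<lambda>n. \<mu> (E n - E (Suc n))) \<longlonglongrightarrow> 0"
    using E by (intro summable_LIMSEQ_zero sums_summable[OF signed_measure_sums[OF \<mu>]]) auto
  then have "eventually (\<lambda>n. \<bar>\<mu> (E n - E (Suc n))\<bar> < 1) sequentially"
    by (auto dest!: tendstoD[where e=1] simp: dist_real_def)
  with E(3) show False by (auto simp: eventually_sequentially dest: less_asym)
qed

lemma finite_measure_pos_variation:
  "signed_measure \<mu> \<Longrightarrow> finite_measure (pos_variation \<mu>)"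
  using pos_var_finite[of \<mu>] sets_eq_imp_space_eq[OF sets_pos_variation[of \<mu>]]
  by (intro finite_measureI) (simp add: emeasure_pos_variation)

text \<open>For a Borel set B inside A, -\<mu> B equals \<mu> (A - B) - \<mu> A, whose first term is
  at most the positive variation of A; finiteness allows the subtraction in the reals. The same
  inequality for -\<mu> is the reverse one, so the Jordan decomposition follows without a Hahn
  set.\<close>

lemma pos_var_uminus_le:
  assumes \<mu>: "signed_measure \<mu>" and A: "A \<in> sets borel"
  shows "enn2real (pos_var (\<lambda>B. - \<mu> B) A) \<le> enn2real (pos_var \<mu> A) - \<mu> A"
proof -
  have "pos_var \<mu> A < \<infinity>"
    using pos_var_mono[of A UNIV \<mu>] pos_var_finite[OF \<mu>]
    by (metis infinity_ennreal_def less_top neq_top_trans subset_UNIV)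
  then have le: "\<mu> B \<le> enn2real (pos_var \<mu> A)" if "B \<in> sets borel" "B \<subseteq> A" for B
    using pos_var_upper[OF that, of \<mu>] enn2real_mono[of "ennreal (\<mu> B)" "pos_var \<mu> A"]
    by (cases "0 \<le> \<mu> B") (auto intro: order_trans[OF _ enn2real_nonneg])
  have "pos_var (\<lambda>B. - \<mu> B) A \<le> ennreal (enn2real (pos_var \<mu> A) - \<mu> A)"
  proof (intro pos_var_least ennreal_leI)
    fix B assume B: "B \<in> sets borel" "B \<subseteq> A"
    show "- \<mu> B \<le> enn2real (pos_var \<mu> A) - \<mu> A"
      using le[of "A - B"] signed_measure_Diff[OF \<mu> A B] A B by auto
  qed
  then show ?thesis
    using le[OF A] enn2real_mono[of "pos_var (\<lambda>B. - \<mu> B) A" "ennreal (enn2real (pos_var \<mu> A) - \<mu> A)"]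
    by simp
qed

lemma Jordan_decomposition:
  assumes \<mu>: "signed_measure \<mu>" and A: "A \<in> sets borel"
  shows "\<mu> A = measure (pos_variation \<mu>) A - measure (neg_variation \<mu>) A"
  using pos_var_uminus_le[OF \<mu> A] pos_var_uminus_le[OF signed_measure_uminus[OF \<mu>] A]
  by (simp add: measure_def neg_variation_def emeasure_pos_variation signed_measure_uminus \<mu> A)

section \<open>Signed measures given by a density with respect to a finite measure\<close>

definition represents :: "'a::topological_space measure \<Rightarrow> ('a \<Rightarrow> real) \<Rightarrow> ('a set \<Rightarrow> real) \<Rightarrow> bool" where
  "represents \<tau> h \<mu> \<longleftrightarrow> finite_measure \<tau> \<and> sets \<tau> = sets borel \<and> integrable \<tau> h \<and>
     (\<forall>A\<in>sets borel. \<mu> A = (LINT x:A|\<tau>. h x))"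

text \<open>The sum dominates every member of the family, so all of them have Radon-Nikodym
  densities with respect to it.\<close>

lemma finite_sum_measure:
  fixes m :: "'i \<Rightarrow> 'a::topological_space measure"
  assumes I: "finite I" and m: "\<And>i. i \<in> I \<Longrightarrow> finite_measure (m i)" "\<And>i. i \<in> I \<Longrightarrow> sets (m i) = sets borel"
  obtains \<tau> where "finite_measure \<tau>" "sets \<tau> = sets borel"
    "\<And>A. A \<in> sets borel \<Longrightarrow> emeasure \<tau> A = (\<Sum>i\<in>I. emeasure (m i) A)"
proof
  define \<tau> where "\<tau> = measure_of UNIV (sets borel) (\<lambda>A. \<Sum>i\<in>I. emeasure (m i) A)"
  show sets: "sets \<tau> = sets borel"
    using sets.sigma_sets_eq[of borel] by (simp add: \<tau>_def sets_measure_of_conv)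
  show em: "emeasure \<tau> A = (\<Sum>i\<in>I. emeasure (m i) A)" if "A \<in> sets borel" for A
  proof (rule emeasure_measure_of[OF \<tau>_def])
    show "countably_additive (sets \<tau>) (\<lambda>A. \<Sum>i\<in>I. emeasure (m i) A)"
      unfolding countably_additive_def sets
    proof (intro allI impI)
      fix A :: "nat \<Rightarrow> 'a set"
      assume A: "range A \<subseteq> sets borel" "disjoint_family A"
      have "(\<Sum>n. \<Sum>i\<in>I. emeasure (m i) (A n)) = (\<Sum>i\<in>I. \<Sum>n. emeasure (m i) (A n))"
        by (rule suminf_sum) auto
      also have "\<dots> = (\<Sum>i\<in>I. emeasure (m i) (\<Union>n. A n))"
        using A m by (intro sum.cong suminf_emeasure) auto
      finally show "(\<Sum>n. \<Sum>i\<in>I. emeasure (m i) (A n)) = (\<Sum>i\<in>I. emeasure (m i) (\<Union>n. A n))" .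
    qed
  qed (use that sets in \<open>auto simp: positive_def\<close>)
  have "(\<Sum>i\<in>I. emeasure (m i) UNIV) \<noteq> \<infinity>"
    using I finite_measure.emeasure_finite[OF m(1)] by auto
  then show "finite_measure \<tau>"
    using sets_eq_imp_space_eq[OF sets] by (intro finite_measureI) (simp add: em)
qed

lemma finite_measure_real_density:
  assumes "finite_measure \<tau>" "finite_measure N" "absolutely_continuous \<tau> N" "sets N = sets \<tau>"
  obtains D where "integrable \<tau> D" "\<And>A. A \<in> sets \<tau> \<Longrightarrow> measure N A = (LINT x:A|\<tau>. D x)"
proof -
  interpret \<tau>: finite_measure \<tau> by fact
  interpret N: finite_measure N by fact
  obtain D where D [measurable]: "D \<in> borel_measurable \<tau>" and
    ae: "AE x in \<tau>. RN_deriv \<tau> N x = ennreal (D x)" and nn: "\<And>x. 0 \<le> D x"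
    using \<tau>.real_RN_deriv[OF assms(2-4)] by metis
  have "N = density \<tau> (RN_deriv \<tau> N)"
    using \<tau>.density_RN_deriv[OF assms(3,4)] by simp
  also have "\<dots> = density \<tau> (\<lambda>x. ennreal (D x))"
    using ae by (intro density_cong) auto
  finally have N: "N = density \<tau> (\<lambda>x. ennreal (D x))" .
  have em: "emeasure N A = (\<integral>\<^sup>+x. ennreal (indicator A x *\<^sub>R D x) \<partial>\<tau>)" if "A \<in> sets \<tau>" for A
    using that by (subst N) (auto simp: emeasure_density intro!: nn_integral_cong split: split_indicator)
  show thesis
  proof
    show int: "integrable \<tau> D"
    proof (rule integrableI_bounded)
      have "(\<integral>\<^sup>+x. ennreal (norm (D x)) \<partial>\<tau>) = emeasure N (space \<tau>)"
        using nn by (subst em) (auto intro!: nn_integral_cong)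
      then show "(\<integral>\<^sup>+x. ennreal (norm (D x)) \<partial>\<tau>) < \<infinity>"
        using N.emeasure_finite[of "space \<tau>"] by (simp only: less_top infinity_ennreal_def)
    qed auto
    show "measure N A = (LINT x:A|\<tau>. D x)" if A: "A \<in> sets \<tau>" for A
      unfolding set_lebesgue_integral_def measure_def em[OF A]
      using nn A by (intro integral_eq_nn_integral[symmetric]) (auto simp: indicator_def)
  qed
qed

lemma common_representation:
  fixes \<mu> :: "'i \<Rightarrow> 'a::topological_space set \<Rightarrow> real"
  assumes I: "finite I" and \<mu>: "\<And>i. i \<in> I \<Longrightarrow> signed_measure (\<mu> i)"
  obtains \<tau> h where "\<And>i. i \<in> I \<Longrightarrow> represents \<tau> (h i) (\<mu> i)"
proof -
  \<comment> \<open>Both variations of every member enter the sum. Each then has its own real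
    density, and the difference of the two densities represents the signed measure.\<close>
  define m where "m = (\<lambda>(i, b). if b then pos_variation (\<mu> i) else neg_variation (\<mu> i))"
  have m: "finite_measure (m (i, b))" "sets (m (i, b)) = sets borel" if "i \<in> I" for i b
    using \<mu>[OF that] finite_measure_pos_variation[of "\<mu> i"]
      finite_measure_pos_variation[OF signed_measure_uminus[of "\<mu> i"]]
    by (auto simp: m_def neg_variation_def)
  obtain \<tau> where \<tau>: "finite_measure \<tau>" "sets \<tau> = sets borel"
    and em: "\<And>A. A \<in> sets borel \<Longrightarrow> emeasure \<tau> A = (\<Sum>p\<in>I \<times> UNIV. emeasure (m p) A)"
    using I m by (rule_tac finite_sum_measure[of "I \<times> (UNIV :: bool set)" m]) auto
  have ex: "\<exists>D. integrable \<tau> D \<and> (\<forall>A\<in>sets borel. measure (m (i, b)) A = (LINT x:A|\<tau>. D x))"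
    if i: "i \<in> I" for i b
  proof -
    have "absolutely_continuous \<tau> (m (i, b))"
    proof (unfold absolutely_continuous_def null_sets_def, safe)
      fix A assume "A \<in> sets \<tau>" "emeasure \<tau> A = 0"
      then show "emeasure (m (i, b)) A = 0" "A \<in> sets (m (i, b))"
        using em[of A] \<tau> m(2)[OF i] i I by (auto simp: sum_eq_0_iff)
    qed
    then show ?thesis
      using finite_measure_real_density[OF \<tau>(1) m(1)[OF i]] \<tau>(2) m(2)[OF i] by metis
  qed
  have "\<forall>i\<in>I. \<exists>h. represents \<tau> h (\<mu> i)"
  proof
    fix i assume i: "i \<in> I"
    obtain D D' where D: "integrable \<tau> D" "integrable \<tau> D'"
      "\<And>A. A \<in> sets borel \<Longrightarrow> measure (pos_variation (\<mu> i)) A = (LINT x:A|\<tau>. D x)"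
      "\<And>A. A \<in> sets borel \<Longrightarrow> measure (neg_variation (\<mu> i)) A = (LINT x:A|\<tau>. D' x)"
      using ex[OF i, of True] ex[OF i, of False] by (auto simp: m_def)
    have "represents \<tau> (\<lambda>x. D x - D' x) (\<mu> i)"
      unfolding represents_def
    proof (intro conjI ballI \<tau> Bochner_Integration.integrable_diff D)
      fix A :: "'a set" assume A: "A \<in> sets borel"
      have "set_integrable \<tau> A D" "set_integrable \<tau> A D'"
        using A \<tau> unfolding set_integrable_def by (auto intro!: integrable_mult_indicator D(1,2) simp del: real_scaleR_def)
      then show "\<mu> i A = (LINT x:A|\<tau>. D x - D' x)"
        using A D Jordan_decomposition[OF \<mu>[OF i] A] by (simp add: set_integral_diff)
    qed
    then show "\<exists>h. represents \<tau> h (\<mu> i)" by blast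
  qed
  then obtain h where "\<And>i. i \<in> I \<Longrightarrow> represents \<tau> (h i) (\<mu> i)" by metis
  then show thesis by (rule that)
qed

lemma representsD:
  assumes "represents \<tau> h \<mu>"
  shows "finite_measure \<tau>" "sets \<tau> = sets borel" "space \<tau> = UNIV" "integrable \<tau> h"
    "h \<in> borel_measurable borel" "\<And>A. A \<in> sets borel \<Longrightarrow> \<mu> A = (LINT x:A|\<tau>. h x)"
  using assms sets_eq_imp_space_eq[of \<tau> borel]
    measurable_cong_sets[of \<tau> borel borel borel] borel_measurable_integrable[of \<tau> h]
  by (auto simp: represents_def)

lemma measurable_represents:
  "represents \<tau> h \<mu> \<Longrightarrow> g \<in> measurable \<tau> N \<longleftrightarrow> g \<in> measurable borel N"
  using measurable_cong_sets[OF representsD(2) refl] by blast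

lemma represents_set_integrable:
  assumes "represents \<tau> h \<mu>" "A \<in> sets borel"
  shows "set_integrable \<tau> A h"
  using assms representsD[OF assms(1)] unfolding set_integrable_def
  by (intro integrable_mult_indicator) auto

text \<open>Closure properties of signed measures are proved through this lemma: for sums,
  restrictions and point masses a density is easier to exhibit than countable additivity.\<close>

lemma signed_measure_if_represents:
  assumes r: "represents \<tau> h \<mu>"
  shows "signed_measure \<mu>"
  unfolding signed_measure_def
proof (intro conjI allI impI)
  note D = representsD[OF r]
  show "\<mu> {} = 0" using D(6)[of "{}"] by (simp add: set_lebesgue_integral_def)
  fix A :: "nat \<Rightarrow> 'a set"
  assume A: "range A \<subseteq> sets borel" "disjoint_family A"
  have "(\<lambda>n. LINT x:A n|\<tau>. h x) sums (LINT x:(\<Union>n. A n)|\<tau>. h x)"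
    unfolding sums_def
  proof -
    have "(\<lambda>n. LINT x:(\<Union>i<n. A i)|\<tau>. h x) \<longlonglongrightarrow> (LINT x:(\<Union>n. \<Union>i<n. A i)|\<tau>. h x)"
      using A represents_set_integrable[OF r, of "\<Union>n. \<Union>i<n. A i"]
      by (intro set_integral_cont_up) (auto simp: incseq_def D(2) intro!: sets.countable_UN intro: less_le_trans)
    moreover have "(\<Union>n. \<Union>i<n. A i) = (\<Union>n. A n)" by auto
    moreover have "(LINT x:(\<Union>i<n. A i)|\<tau>. h x) = (\<Sum>i<n. LINT x:A i|\<tau>. h x)" for n
      using A represents_set_integrable[OF r]
      by (intro set_integral_finite_Union) (auto simp: disjoint_family_on_def D(2))
    ultimately show "(\<lambda>n. \<Sum>i<n. LINT x:A i|\<tau>. h x) \<longlonglongrightarrow> (LINT x:(\<Union>n. A n)|\<tau>. h x)"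
      by simp
  qed
  then show "(\<lambda>n. \<mu> (A n)) sums \<mu> (\<Union>n. A n)"
    using A D(6) by (simp add: range_subsetD sets.countable_UN)
qed

text \<open>The index set is nonempty because it is a member of the family that guarantees that
  \<tau> is finite and lives on the Borel sets.\<close>

lemma represents_sum:
  assumes I: "finite I" "I \<noteq> {}" and r: "\<And>i. i \<in> I \<Longrightarrow> represents \<tau> (h i) (\<mu> i)"
  shows "represents \<tau> (\<lambda>x. \<Sum>i\<in>I. a i * h i x) (\<lambda>A. \<Sum>i\<in>I. a i * \<mu> i A)"
proof -
  obtain i where "i \<in> I" using I by auto
  note D = representsD[OF r]
  have "(\<Sum>i\<in>I. a i * \<mu> i A) = (LINT x:A|\<tau>. \<Sum>i\<in>I. a i * h i x)" if A: "A \<in> sets borel" for A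
  proof -
    have "(LINT x:A|\<tau>. \<Sum>i\<in>I. a i * h i x) = (LINT x|\<tau>. (\<Sum>i\<in>I. a i * (indicator A x *\<^sub>R h i x)))"
      unfolding set_lebesgue_integral_def
      by (intro Bochner_Integration.integral_cong) (auto simp: sum_distrib_left ac_simps)
    also have "\<dots> = (\<Sum>i\<in>I. a i * (LINT x:A|\<tau>. h i x))"
      unfolding set_lebesgue_integral_def
      using represents_set_integrable[OF r A]
      by (subst Bochner_Integration.integral_sum) (auto simp: set_integrable_def)
    finally show ?thesis using D(6) A by simp
  qed
  then show ?thesis
    using D \<open>i \<in> I\<close> by (auto simp: represents_def)
qed

lemma represents_uminus:
  assumes "represents \<tau> h \<mu>"
  shows "represents \<tau> (\<lambda>x. - h x) (\<lambda>A. - \<mu> A)"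
  using represents_sum[of "{()}" \<tau> "\<lambda>_. h" "\<lambda>_. \<mu>" "\<lambda>_. -1"] assms by simp

lemma represents_restrict:
  assumes r: "represents \<tau> h \<mu>" and A: "A \<in> sets borel"
  shows "represents \<tau> (\<lambda>x. indicator A x * h x) (\<lambda>B. \<mu> (B \<inter> A))"
proof -
  note D = representsD[OF r]
  have "integrable \<tau> (\<lambda>x. indicator A x * h x)"
    using represents_set_integrable[OF r A] by (simp add: set_integrable_def)
  moreover have "(LINT x:B \<inter> A|\<tau>. h x) = (LINT x:B|\<tau>. indicator A x * h x)" for B
    unfolding set_lebesgue_integral_def
    by (intro Bochner_Integration.integral_cong) (auto split: split_indicator)
  ultimately show ?thesis using D A by (auto simp: represents_def)
qed

lemma represents_point_mass: "represents (return borel t) (\<lambda>_. 1) (point_mass t)"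
proof -
  interpret prob_space "return borel t" by (rule prob_space_return) simp
  show ?thesis
    by (auto simp: represents_def set_lebesgue_integral_def integral_return point_mass_def measure_def indicator_def
        finite_measure_axioms)
qed

section \<open>Variations and integrals expressed by densities\<close>

lemma pos_variation_represents:
  assumes r: "represents \<tau> h \<mu>"
  shows "pos_variation \<mu> = density \<tau> (\<lambda>x. ennreal (h x))"
proof (rule measure_eqI)
  note D = representsD[OF r]
  have [measurable]: "h \<in> borel_measurable \<tau>" using D(4) by auto
  show "sets (pos_variation \<mu>) = sets (density \<tau> (\<lambda>x. ennreal (h x)))"
    using D by simp
  fix A assume "A \<in> sets (pos_variation \<mu>)"
  then have A: "A \<in> sets borel" by simp
  then have [measurable]: "A \<in> sets \<tau>" using D by simp
  have \<mu>: "ennreal (\<mu> B) \<le> (\<integral>\<^sup>+x\<in>B. ennreal (h x) \<partial>\<tau>)" if "B \<in> sets borel" for B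
  proof -
    have [measurable]: "B \<in> sets \<tau>" using that D by simp
    note int = represents_set_integrable[OF r that, unfolded set_integrable_def]
    have "\<mu> B \<le> (LINT x|\<tau>. max 0 (indicator B x *\<^sub>R h x))"
      unfolding D(6)[OF that] set_lebesgue_integral_def
      using int by (intro integral_mono integrable_max) auto
    then have "ennreal (\<mu> B) \<le> ennreal (LINT x|\<tau>. max 0 (indicator B x *\<^sub>R h x))"
      by (rule ennreal_leI)
    also have "\<dots> = (\<integral>\<^sup>+x. ennreal (max 0 (indicator B x *\<^sub>R h x)) \<partial>\<tau>)"
      using int by (intro nn_integral_eq_integral[symmetric] integrable_max) auto
    also have "\<dots> = (\<integral>\<^sup>+x\<in>B. ennreal (h x) \<partial>\<tau>)"
      by (intro nn_integral_cong) (auto split: split_indicator simp: max_def ennreal_neg)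
    finally show ?thesis .
  qed
  show "emeasure (pos_variation \<mu>) A = emeasure (density \<tau> (\<lambda>x. ennreal (h x))) A"
    unfolding emeasure_pos_variation[OF signed_measure_if_represents[OF r] A]
  proof (rule antisym)
    show "pos_var \<mu> A \<le> emeasure (density \<tau> (\<lambda>x. ennreal (h x))) A"
    proof (rule pos_var_least)
      fix B assume B: "B \<in> sets borel" "B \<subseteq> A"
      have "(\<integral>\<^sup>+x\<in>B. ennreal (h x) \<partial>\<tau>) \<le> (\<integral>\<^sup>+x\<in>A. ennreal (h x) \<partial>\<tau>)"
        using B by (intro nn_integral_mono) (auto split: split_indicator)
      with \<mu>[OF B(1)] show "ennreal (\<mu> B) \<le> emeasure (density \<tau> (\<lambda>x. ennreal (h x))) A"
        by (simp add: emeasure_density)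
    qed
    \<comment> \<open>The supremum is attained here: the set where the density is positive acts as
      the positive set of a Hahn decomposition.\<close>
    define B where "B = A \<inter> {x. 0 < h x}"
    have [measurable]: "h \<in> borel_measurable borel" by (rule D(5))
    have B: "B \<in> sets borel" unfolding B_def using A by measurable
    then have [measurable]: "B \<in> sets \<tau>" using D by simp
    note int = represents_set_integrable[OF r B, unfolded set_integrable_def]
    have "emeasure (density \<tau> (\<lambda>x. ennreal (h x))) A = (\<integral>\<^sup>+x. ennreal (indicator B x *\<^sub>R h x) \<partial>\<tau>)"
      by (subst emeasure_density) (auto intro!: nn_integral_cong split: split_indicator simp: B_def ennreal_neg)
    also have "\<dots> = ennreal (\<mu> B)"
      unfolding D(6)[OF B] set_lebesgue_integral_def
      using int by (intro nn_integral_eq_integral) (auto simp: B_def indicator_def)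
    also have "\<dots> \<le> pos_var \<mu> A"
      using B by (intro pos_var_upper) (auto simp: B_def)
    finally show "emeasure (density \<tau> (\<lambda>x. ennreal (h x))) A \<le> pos_var \<mu> A" .
  qed
qed

lemma neg_variation_represents:
  "represents \<tau> h \<mu> \<Longrightarrow> neg_variation \<mu> = density \<tau> (\<lambda>x. ennreal (- h x))"
  unfolding neg_variation_def by (rule pos_variation_represents[OF represents_uminus])

lemma sets_total_variation [simp]: "sets (total_variation \<mu>) = sets borel"
  using sets.sigma_sets_eq[of borel] by (simp add: total_variation_def sets_measure_of_conv)

lemma total_variation_represents:
  assumes r: "represents \<tau> h \<mu>"
  shows "total_variation \<mu> = density \<tau> (\<lambda>x. ennreal \<bar>h x\<bar>)"
proof (rule measure_eqI)
  note D = representsD[OF r]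
  have [measurable]: "h \<in> borel_measurable \<tau>" using D(4) by auto
  \<comment> \<open>The positive parts of h and -h add up to |h|. Thus the sum of the two variations
    agrees with a genuine measure, which yields the countable additivity that
    \<open>measure_of\<close> asks for.\<close>
  have em: "emeasure (pos_variation \<mu>) A + emeasure (neg_variation \<mu>) A
      = emeasure (density \<tau> (\<lambda>x. ennreal \<bar>h x\<bar>)) A" if "A \<in> sets borel" for A
  proof -
    have [measurable]: "A \<in> sets \<tau>" using that D by simp
    show ?thesis
      unfolding pos_variation_represents[OF r] neg_variation_represents[OF r]
      by (subst (1 2 3) emeasure_density, simp_all, subst nn_integral_add[symmetric])
        (auto intro!: nn_integral_cong split: split_indicator simp: abs_if ennreal_neg)
  qed
  show "sets (total_variation \<mu>) = sets (density \<tau> (\<lambda>x. ennreal \<bar>h x\<bar>))"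
    using D by simp
  fix A assume "A \<in> sets (total_variation \<mu>)"
  then have A: "A \<in> sets borel" by simp
  have "emeasure (total_variation \<mu>) A = emeasure (pos_variation \<mu>) A + emeasure (neg_variation \<mu>) A"
  proof (rule emeasure_measure_of[OF total_variation_def])
    show "countably_additive (sets (total_variation \<mu>))
        (\<lambda>A. emeasure (pos_variation \<mu>) A + emeasure (neg_variation \<mu>) A)"
      unfolding countably_additive_def
    proof (intro allI impI)
      fix A :: "nat \<Rightarrow> 'a set"
      assume A: "range A \<subseteq> sets (total_variation \<mu>)" "disjoint_family A"
      then have [simp]: "A n \<in> sets borel" for n by auto
      have "(\<Sum>n. emeasure (density \<tau> (\<lambda>x. ennreal \<bar>h x\<bar>)) (A n))
          = emeasure (density \<tau> (\<lambda>x. ennreal \<bar>h x\<bar>)) (\<Union>n. A n)"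
        using A D(2) by (intro suminf_emeasure) auto
      then show "(\<Sum>n. emeasure (pos_variation \<mu>) (A n) + emeasure (neg_variation \<mu>) (A n))
          = emeasure (pos_variation \<mu>) (\<Union>n. A n) + emeasure (neg_variation \<mu>) (\<Union>n. A n)"
        using em[of "\<Union>n. A n"] sets.countable_UN[of A UNIV borel] by (simp add: em image_subset_iff)
    qed
  qed (use A in \<open>auto simp: positive_def\<close>)
  with em[OF A] show "emeasure (total_variation \<mu>) A = emeasure (density \<tau> (\<lambda>x. ennreal \<bar>h x\<bar>)) A"
    by simp
qed

lemma signed_integrable_measurable:
  "signed_integrable \<mu> A g \<Longrightarrow> set_borel_measurable borel A g"
  unfolding signed_integrable_def set_integrable_def set_borel_measurable_def
  using measurable_cong_sets[of "total_variation \<mu>" borel borel borel]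
  by (auto dest!: borel_measurable_integrable)

text \<open>The total variation has density |h|, and integrability depends on norms only, so the
  sign of h can be restored. Measurability of g is a separate premise for the direction from right
  to left: where h vanishes, the product carries no information about g.\<close>

lemma signed_integrable_iff:
  assumes r: "represents \<tau> h \<mu>" and g: "set_borel_measurable borel A g"
  shows "signed_integrable \<mu> A g \<longleftrightarrow> integrable \<tau> (\<lambda>x. h x *\<^sub>R (indicator A x *\<^sub>R g x))"
proof -
  note D = representsD[OF r]
  have [measurable]: "h \<in> borel_measurable \<tau>" using D(4) by auto
  have [measurable]: "(\<lambda>x. indicator A x *\<^sub>R g x) \<in> borel_measurable \<tau>"
    using g by (simp add: set_borel_measurable_def measurable_represents[OF r])
  have "signed_integrable \<mu> A g \<longleftrightarrow> integrable \<tau> (\<lambda>x. \<bar>h x\<bar> *\<^sub>R (indicator A x *\<^sub>R g x))"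
    unfolding signed_integrable_def set_integrable_def total_variation_represents[OF r]
    by (rule integrable_density) auto
  also have "\<dots> \<longleftrightarrow> integrable \<tau> (\<lambda>x. h x *\<^sub>R (indicator A x *\<^sub>R g x))"
    by (intro iffI; erule Bochner_Integration.integrable_bound) (auto simp del: scaleR_scaleR)
  finally show ?thesis .
qed

lemma signed_integrable_density:
  assumes "represents \<tau> h \<mu>" "signed_integrable \<mu> A g"
  shows "integrable \<tau> (\<lambda>x. h x *\<^sub>R (indicator A x *\<^sub>R g x))"
  using signed_integrable_iff[OF assms(1) signed_integrable_measurable[OF assms(2)]] assms by simp

lemma signed_integral_eq:
  assumes r: "represents \<tau> h \<mu>" and g: "signed_integrable \<mu> A g"
  shows "signed_integral \<mu> A g = (LINT x|\<tau>. h x *\<^sub>R (indicator A x *\<^sub>R g x))"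
proof -
  note D = representsD[OF r]
  note int = signed_integrable_density[OF r g]
  have [measurable]: "h \<in> borel_measurable \<tau>" using D(4) by auto
  have [measurable]: "(\<lambda>x. indicator A x *\<^sub>R g x) \<in> borel_measurable \<tau>"
    using signed_integrable_measurable[OF g]
    by (simp add: set_borel_measurable_def measurable_represents[OF r])
  \<comment> \<open>\<open>integral_density\<close> expects a nonnegative real density; since
    \<open>ennreal\<close> has already discarded the negative part, h may be replaced by its
    positive part.\<close>
  have max: "(\<lambda>x. ennreal (h x)) = (\<lambda>x. ennreal (max 0 (h x)))" for h :: "'a \<Rightarrow> real"
    by (auto simp: max_def ennreal_neg)
  have "signed_integral \<mu> A g = (LINT x|\<tau>. max 0 (h x) *\<^sub>R (indicator A x *\<^sub>R g x))
      - (LINT x|\<tau>. max 0 (- h x) *\<^sub>R (indicator A x *\<^sub>R g x))"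
    unfolding signed_integral_def set_lebesgue_integral_def
      pos_variation_represents[OF r] neg_variation_represents[OF r]
    by (subst max, subst (2) max, subst (1 2) integral_density) auto
  also have "\<dots> = (LINT x|\<tau>. max 0 (h x) *\<^sub>R (indicator A x *\<^sub>R g x)
      - max 0 (- h x) *\<^sub>R (indicator A x *\<^sub>R g x))"
    by (intro Bochner_Integration.integral_diff[symmetric] Bochner_Integration.integrable_bound[OF int])
      (auto intro!: AE_I2 mult_right_mono simp del: scaleR_scaleR)
  also have "\<dots> = (LINT x|\<tau>. h x *\<^sub>R (indicator A x *\<^sub>R g x))"
    by (intro Bochner_Integration.integral_cong refl) (auto simp: max_def)
  finally show ?thesis .
qed

section \<open>Double integrals of the kernel as integrals over a product measure\<close>

definition kernel_on :: "('a \<Rightarrow> 'a \<Rightarrow> real) \<Rightarrow> 'a set \<Rightarrow> 'a set \<Rightarrow> 'a \<Rightarrow> 'a \<Rightarrow> real" where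
  "kernel_on K A B t s = indicator A t * indicator B s * K t s"

text \<open>Measurability of K is drawn from integrability, and only for the kernel cut off outside
  A \<times> B. The \<sigma>-algebra of a total variation is the Borel one, without completion, so
  the conclusion is independent of \<mu> and \<rho> and can be reused for other measures on the same
  sets.\<close>

lemma kernel_integrable_measurable:
  assumes "kernel_integrable K A \<mu> B \<rho>"
  shows "(\<lambda>(t, s). kernel_on K A B t s) \<in> borel_measurable (borel \<Otimes>\<^sub>M borel)"
proof -
  have eq: "(\<lambda>p. indicat_real (A \<times> B) p *\<^sub>R (case p of (t, s) \<Rightarrow> K t s)) = (\<lambda>(t, s). kernel_on K A B t s)"
    by (auto simp: kernel_on_def indicator_def)
  have "sets (total_variation \<mu> \<Otimes>\<^sub>M total_variation \<rho>) = sets (borel \<Otimes>\<^sub>M borel)"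
    by (intro sets_pair_measure_cong) auto
  from measurable_cong_sets[OF this refl] show ?thesis
    using assms unfolding kernel_integrable_def set_integrable_def eq
    by (auto dest!: borel_measurable_integrable)
qed

lemma kernel_integrable_iff:
  assumes r: "represents \<tau> h \<mu>" and r': "represents \<sigma> k \<rho>"
    and K: "(\<lambda>(t, s). kernel_on K A B t s) \<in> borel_measurable (borel \<Otimes>\<^sub>M borel)"
  shows "kernel_integrable K A \<mu> B \<rho> \<longleftrightarrow>
    integrable (\<tau> \<Otimes>\<^sub>M \<sigma>) (\<lambda>(t, s). h t * k s * kernel_on K A B t s)"
proof -
  note D = representsD[OF r] and D' = representsD[OF r']
  interpret \<sigma>: finite_measure \<sigma> by (rule D')
  have [measurable]: "h \<in> borel_measurable \<tau>" "k \<in> borel_measurable \<sigma>" using D(4) D'(4) by auto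
  have eq: "(\<lambda>p. indicat_real (A \<times> B) p *\<^sub>R (case p of (t, s) \<Rightarrow> K t s)) = (\<lambda>(t, s). kernel_on K A B t s)"
    by (auto simp: kernel_on_def indicator_def)
  have [measurable]: "(\<lambda>(t, s). kernel_on K A B t s) \<in> borel_measurable (\<tau> \<Otimes>\<^sub>M \<sigma>)"
    using K measurable_cong_sets[OF sets_pair_measure_cong[OF D(2) D'(2)] refl] by auto
  \<comment> \<open>\<open>pair_measure_density\<close> needs the second factor, taken with its
    density, to be \<sigma>-finite; its total mass is the integral of |k|.\<close>
  have "finite_measure (density \<sigma> (\<lambda>x. ennreal \<bar>k x\<bar>))"
  proof (rule finite_measureI)
    have "emeasure (density \<sigma> (\<lambda>x. ennreal \<bar>k x\<bar>)) (space (density \<sigma> (\<lambda>x. ennreal \<bar>k x\<bar>)))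
        = (\<integral>\<^sup>+x. ennreal (norm (k x)) \<partial>\<sigma>)"
      by (subst emeasure_density) (auto intro!: nn_integral_cong)
    then show "emeasure (density \<sigma> (\<lambda>x. ennreal \<bar>k x\<bar>)) (space (density \<sigma> (\<lambda>x. ennreal \<bar>k x\<bar>))) \<noteq> \<infinity>"
      using D'(4) by (simp add: integrable_iff_bounded)
  qed
  then interpret k: finite_measure "density \<sigma> (\<lambda>x. ennreal \<bar>k x\<bar>)" .
  have "total_variation \<mu> \<Otimes>\<^sub>M total_variation \<rho> =
      density (\<tau> \<Otimes>\<^sub>M \<sigma>) (\<lambda>(t, s). ennreal \<bar>h t\<bar> * ennreal \<bar>k s\<bar>)"
    unfolding total_variation_represents[OF r] total_variation_represents[OF r']
    by (rule pair_measure_density) (auto intro: \<sigma>.sigma_finite_measure_axioms k.sigma_finite_measure_axioms)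
  also have "(\<lambda>(t, s). ennreal \<bar>h t\<bar> * ennreal \<bar>k s\<bar>) = (\<lambda>p. ennreal (case p of (t, s) \<Rightarrow> \<bar>h t * k s\<bar>))"
    by (auto simp: ennreal_mult abs_mult)
  finally have "kernel_integrable K A \<mu> B \<rho> \<longleftrightarrow> integrable (\<tau> \<Otimes>\<^sub>M \<sigma>)
      (\<lambda>p. (case p of (t, s) \<Rightarrow> \<bar>h t * k s\<bar>) *\<^sub>R (case p of (t, s) \<Rightarrow> kernel_on K A B t s))"
    unfolding kernel_integrable_def set_integrable_def eq
    by (simp only:) (rule integrable_density, auto)
  also have "\<dots> \<longleftrightarrow> integrable (\<tau> \<Otimes>\<^sub>M \<sigma>) (\<lambda>(t, s). h t * k s * kernel_on K A B t s)"
    by (intro iffI; erule Bochner_Integration.integrable_bound) (auto simp: abs_mult)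
  finally show ?thesis .
qed

lemma kernel_integrable_density:
  assumes "represents \<tau> h \<mu>" "represents \<sigma> k \<rho>" "kernel_integrable K A \<mu> B \<rho>"
  shows "integrable (\<tau> \<Otimes>\<^sub>M \<sigma>) (\<lambda>(t, s). h t * k s * kernel_on K A B t s)"
  using kernel_integrable_iff[OF assms(1,2) kernel_integrable_measurable[OF assms(3)]] assms by simp

text \<open>\<open>kernel_integral\<close> is an iterated integral whose inner integral may diverge
  for exceptional t. Fubini makes it converge, and agree with the section of the product integral,
  for \<tau>-almost every t with \<open>h t\<close> nonzero in A; elsewhere the weight is 0. The
  first conclusion serves to split the integral of a potential plus another function.\<close>

lemma kernel_integral_eq:
  assumes r: "represents \<tau> h \<mu>" and r': "represents \<sigma> k \<rho>" and K: "kernel_integrable K A \<mu> B \<rho>"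
  shows "signed_integrable \<mu> A (\<lambda>t. signed_integral \<rho> B (K t))"
    and "kernel_integral K A \<mu> B \<rho> = (LINT p|(\<tau> \<Otimes>\<^sub>M \<sigma>). (case p of (t, s) \<Rightarrow> h t * k s * kernel_on K A B t s))"
proof -
  note D = representsD[OF r] and D' = representsD[OF r']
  interpret \<tau>: finite_measure \<tau> by (rule D)
  interpret \<sigma>: finite_measure \<sigma> by (rule D')
  interpret pair_sigma_finite \<tau> \<sigma> ..
  note int = kernel_integrable_density[OF r r' K]
  note mK = kernel_integrable_measurable[OF K]
  have sec: "(\<lambda>s. kernel_on K A B t s) \<in> borel_measurable borel" for t
    using measurable_compose[OF measurable_Pair1' mK, of t] by simp
  define F where "F t = signed_integral \<rho> B (K t)" for t
  \<comment> \<open>The density formula for the inner integral is available only almost everywhere.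
    Measurability for all t is read off from the definition of \<open>signed_integral\<close> by the
    two variations of \<rho>.\<close>
  have F_meas: "set_borel_measurable borel A F"
  proof -
    have \<rho>: "signed_measure \<rho>" using r' by (rule signed_measure_if_represents)
    interpret P: finite_measure "pos_variation \<rho>" by (rule finite_measure_pos_variation[OF \<rho>])
    interpret N: finite_measure "neg_variation \<rho>"
      unfolding neg_variation_def by (rule finite_measure_pos_variation[OF signed_measure_uminus[OF \<rho>]])
    have "(\<lambda>t. indicator A t *\<^sub>R F t) =
        (\<lambda>t. (LINT s|pos_variation \<rho>. kernel_on K A B t s) - (LINT s|neg_variation \<rho>. kernel_on K A B t s))"
      by (auto simp: F_def signed_integral_def set_lebesgue_integral_def kernel_on_def indicator_def)
    also have "\<dots> \<in> borel_measurable borel"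
    proof (intro borel_measurable_diff P.borel_measurable_lebesgue_integral N.borel_measurable_lebesgue_integral)
      show "(\<lambda>(t, s). kernel_on K A B t s) \<in> borel_measurable (borel \<Otimes>\<^sub>M pos_variation \<rho>)"
        using measurable_cong_sets[OF sets_pair_measure_cong[OF refl sets_pos_variation] refl] mK by blast
      show "(\<lambda>(t, s). kernel_on K A B t s) \<in> borel_measurable (borel \<Otimes>\<^sub>M neg_variation \<rho>)"
        unfolding neg_variation_def
        using measurable_cong_sets[OF sets_pair_measure_cong[OF refl sets_pos_variation] refl] mK by blast
    qed
    finally show ?thesis by (simp add: set_borel_measurable_def)
  qed
  \<comment> \<open>Where the outer weight vanishes both sides are 0; elsewhere dividing by
    \<open>h t\<close> turns integrability of the weighted section into integrability of
    \<open>K t\<close> against \<rho>.\<close>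
  have sec_eq: "h t *\<^sub>R (indicator A t *\<^sub>R F t) = (LINT s|\<sigma>. h t * k s * kernel_on K A B t s)"
    if "integrable \<sigma> (\<lambda>s. h t * k s * kernel_on K A B t s)" for t
  proof (cases "h t = 0 \<or> t \<notin> A")
    case True
    then show ?thesis by (auto simp: kernel_on_def)
  next
    case False
    then have eq: "kernel_on K A B t = (\<lambda>s. indicator B s *\<^sub>R K t s)"
      by (auto simp: kernel_on_def)
    have "integrable \<sigma> (\<lambda>s. inverse (h t) * (h t * k s * kernel_on K A B t s))"
      using that by simp
    also have "(\<lambda>s. inverse (h t) * (h t * k s * kernel_on K A B t s)) = (\<lambda>s. k s *\<^sub>R (indicator B s *\<^sub>R K t s))"
      using False by (auto simp: eq)
    finally have 1: "signed_integrable \<rho> B (K t)"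
      using sec[of t] by (subst signed_integrable_iff[OF r']) (auto simp: set_borel_measurable_def eq)
    have "h t *\<^sub>R (indicator A t *\<^sub>R F t) = (LINT s|\<sigma>. h t * (k s * (indicator B s * K t s)))"
      using signed_integral_eq[OF r' 1] False by (simp add: F_def)
    also have "\<dots> = (LINT s|\<sigma>. h t * k s * kernel_on K A B t s)"
      by (simp add: eq mult.assoc)
    finally show ?thesis .
  qed
  have ae: "AE t in \<tau>. (LINT s|\<sigma>. h t * k s * kernel_on K A B t s) = h t *\<^sub>R (indicator A t *\<^sub>R F t)"
    using AE_integrable_fst'[OF int] by eventually_elim (rule sec_eq[symmetric], simp)
  have m: "(\<lambda>t. h t *\<^sub>R (indicator A t *\<^sub>R F t)) \<in> borel_measurable \<tau>"
    using F_meas D(5)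
    by (simp add: set_borel_measurable_def measurable_represents[OF r] borel_measurable_times)
  have m': "(\<lambda>t. LINT s|\<sigma>. h t * k s * kernel_on K A B t s) \<in> borel_measurable \<tau>"
    using integrable_fst'[OF int] by auto
  have "integrable \<tau> (\<lambda>t. h t *\<^sub>R (indicator A t *\<^sub>R F t))"
    using integrable_fst'[OF int] integrable_cong_AE[OF m' m ae] by simp
  then have si: "signed_integrable \<mu> A F"
    by (subst signed_integrable_iff[OF r F_meas])
  then show "signed_integrable \<mu> A (\<lambda>t. signed_integral \<rho> B (K t))"
    by (simp add: F_def[abs_def])
  have "kernel_integral K A \<mu> B \<rho> = (LINT t|\<tau>. h t *\<^sub>R (indicator A t *\<^sub>R F t))"
    using signed_integral_eq[OF r si] by (simp add: kernel_integral_def F_def[abs_def])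
  also have "\<dots> = (LINT t|\<tau>. LINT s|\<sigma>. h t * k s * kernel_on K A B t s)"
    using integral_cong_AE[OF m' m ae] by simp
  also have "\<dots> = (LINT p|(\<tau> \<Otimes>\<^sub>M \<sigma>). (case p of (t, s) \<Rightarrow> h t * k s * kernel_on K A B t s))"
    using integral_fst'[OF int] by simp
  finally show "kernel_integral K A \<mu> B \<rho> = (LINT p|(\<tau> \<Otimes>\<^sub>M \<sigma>). (case p of (t, s) \<Rightarrow> h t * k s * kernel_on K A B t s))" .
qed

section \<open>Calculus of signed integrals and kernel integrals\<close>

lemma signed_integral_cong:
  "(\<And>x. x \<in> A \<Longrightarrow> g x = g' x) \<Longrightarrow> signed_integral \<mu> A g = signed_integral \<mu> A g'"
  unfolding signed_integral_def set_lebesgue_integral_def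
  by (intro arg_cong2[of _ _ _ _ "(-)"] Bochner_Integration.integral_cong) (auto simp: indicator_def)

lemma signed_integrable_cong:
  "(\<And>x. x \<in> A \<Longrightarrow> g x = g' x) \<Longrightarrow> signed_integrable \<mu> A g \<longleftrightarrow> signed_integrable \<mu> A g'"
  unfolding signed_integrable_def set_integrable_def
  by (intro Bochner_Integration.integrable_cong) (auto simp: indicator_def)

lemma signed_measure_representation:
  assumes "signed_measure \<mu>"
  obtains \<tau> h where "represents \<tau> h \<mu>"
proof (rule common_representation[of "{()}" "\<lambda>_. \<mu>"])
  fix \<tau> :: "'a measure" and h :: "unit \<Rightarrow> 'a \<Rightarrow> real"
  assume "\<And>i. i \<in> {()} \<Longrightarrow> represents \<tau> (h i) \<mu>"
  then show thesis by (intro that[of \<tau> "h ()"]) simp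
qed (use assms in auto)

lemma signed_measure_sum:
  assumes I: "finite I" "I \<noteq> {}" and \<mu>: "\<And>i. i \<in> I \<Longrightarrow> signed_measure (\<mu> i)"
  shows "signed_measure (\<lambda>B. \<Sum>i\<in>I. a i * \<mu> i B)"
proof -
  obtain \<tau> h where "\<And>i. i \<in> I \<Longrightarrow> represents \<tau> (h i) (\<mu> i)"
    using common_representation[of I \<mu>] I(1) \<mu> by metis
  then show ?thesis
    by (intro signed_measure_if_represents[OF represents_sum[OF I]])
qed

lemma signed_integral_sum:
  assumes I: "finite I" "I \<noteq> {}" and \<mu>: "\<And>i. i \<in> I \<Longrightarrow> signed_measure (\<mu> i)"
    and g: "\<And>i. i \<in> I \<Longrightarrow> signed_integrable (\<mu> i) A g"
  shows "signed_integrable (\<lambda>B. \<Sum>i\<in>I. a i * \<mu> i B) A g"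
    and "signed_integral (\<lambda>B. \<Sum>i\<in>I. a i * \<mu> i B) A g = (\<Sum>i\<in>I. a i *\<^sub>R signed_integral (\<mu> i) A g)"
proof -
  obtain \<tau> h where r: "\<And>i. i \<in> I \<Longrightarrow> represents \<tau> (h i) (\<mu> i)"
    using common_representation[of I \<mu>] I(1) \<mu> by metis
  have R: "represents \<tau> (\<lambda>x. \<Sum>i\<in>I. a i * h i x) (\<lambda>B. \<Sum>i\<in>I. a i * \<mu> i B)"
    by (rule represents_sum[OF I r])
  obtain i where i: "i \<in> I" using I by auto
  note int = signed_integrable_density[OF r g]
  have eq: "(\<Sum>i\<in>I. a i * h i x) *\<^sub>R (indicator A x *\<^sub>R g x)
      = (\<Sum>i\<in>I. a i *\<^sub>R h i x *\<^sub>R (indicator A x *\<^sub>R g x))" for x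
    by (simp add: scaleR_sum_left[symmetric] sum_distrib_right mult.assoc)
  have int': "integrable \<tau> (\<lambda>x. (\<Sum>i\<in>I. a i * h i x) *\<^sub>R (indicator A x *\<^sub>R g x))"
    unfolding eq using int by (intro Bochner_Integration.integrable_sum integrable_scaleR_right)
  show si: "signed_integrable (\<lambda>B. \<Sum>i\<in>I. a i * \<mu> i B) A g"
    unfolding signed_integrable_iff[OF R signed_integrable_measurable[OF g[OF i]]] by (rule int')
  show "signed_integral (\<lambda>B. \<Sum>i\<in>I. a i * \<mu> i B) A g = (\<Sum>i\<in>I. a i *\<^sub>R signed_integral (\<mu> i) A g)"
    unfolding signed_integral_eq[OF R si] eq
    using int by (subst Bochner_Integration.integral_sum) (auto simp: signed_integral_eq[OF r g] intro!: sum.cong simp del: scaleR_scaleR)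
qed

text \<open>Used with L a coordinate or the inner product with a fixed vector, to pass from the
  vector integral of \<open>f\<close> to scalar integrals.\<close>

lemma signed_integral_linear:
  assumes \<mu>: "signed_measure \<mu>" and L: "bounded_linear L" and g: "signed_integrable \<mu> A g"
  shows "signed_integrable \<mu> A (\<lambda>x. L (g x))"
    and "signed_integral \<mu> A (\<lambda>x. L (g x)) = L (signed_integral \<mu> A g)"
proof -
  obtain \<tau> h where r: "represents \<tau> h \<mu>" using signed_measure_representation[OF \<mu>] .
  note int = signed_integrable_density[OF r g]
  interpret bounded_linear L by (rule L)
  have eq: "c *\<^sub>R (d *\<^sub>R L v) = L (c *\<^sub>R (d *\<^sub>R v))" for c d v by (simp add: scaleR)
  have "set_borel_measurable borel A (\<lambda>x. L (g x))"
    using measurable_compose[OF _ borel_measurable_continuous_onI[OF linear_continuous_on[OF L]]]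
      signed_integrable_measurable[OF g]
    unfolding set_borel_measurable_def scaleR[symmetric] by blast
  then show si: "signed_integrable \<mu> A (\<lambda>x. L (g x))"
    unfolding signed_integrable_iff[OF r] eq
    by (subst signed_integrable_iff[OF r]) (auto simp only: eq intro: integrable_bounded_linear[OF L int])
  show "signed_integral \<mu> A (\<lambda>x. L (g x)) = L (signed_integral \<mu> A g)"
    unfolding signed_integral_eq[OF r si] signed_integral_eq[OF r g] eq
    by (rule integral_bounded_linear[OF L int])
qed

lemma signed_integral_add:
  assumes \<mu>: "signed_measure \<mu>" and g: "signed_integrable \<mu> A g" "signed_integrable \<mu> A g'"
  shows "signed_integral \<mu> A (\<lambda>x. g x + g' x) = signed_integral \<mu> A g + signed_integral \<mu> A g'"
proof -
  obtain \<tau> h where r: "represents \<tau> h \<mu>" using signed_measure_representation[OF \<mu>] .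
  have eq: "h x *\<^sub>R (indicator A x *\<^sub>R (g x + g' x)) =
      h x *\<^sub>R (indicator A x *\<^sub>R g x) + h x *\<^sub>R (indicator A x *\<^sub>R g' x)" for x
    by (simp add: scaleR_add_right)
  note int = signed_integrable_density[OF r g(1)] signed_integrable_density[OF r g(2)]
  have "set_borel_measurable borel A (\<lambda>x. g x + g' x)"
    using signed_integrable_measurable[OF g(1)] signed_integrable_measurable[OF g(2)]
    by (simp add: set_borel_measurable_def scaleR_add_right)
  then have "signed_integrable \<mu> A (\<lambda>x. g x + g' x)"
    using int by (simp add: signed_integrable_iff[OF r] eq del: scaleR_scaleR)
  from signed_integral_eq[OF r this] int show ?thesis
    by (simp add: eq signed_integral_eq[OF r g(1)] signed_integral_eq[OF r g(2)] del: scaleR_scaleR)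
qed

lemma kernel_sum_left:
  assumes I: "finite I" "I \<noteq> {}" and \<mu>: "\<And>i. i \<in> I \<Longrightarrow> signed_measure (\<mu> i)" and \<rho>: "signed_measure \<rho>"
    and K: "\<And>i. i \<in> I \<Longrightarrow> kernel_integrable K A (\<mu> i) B \<rho>"
  shows "kernel_integrable K A (\<lambda>C. \<Sum>i\<in>I. a i * \<mu> i C) B \<rho>"
    and "kernel_integral K A (\<lambda>C. \<Sum>i\<in>I. a i * \<mu> i C) B \<rho> = (\<Sum>i\<in>I. a i * kernel_integral K A (\<mu> i) B \<rho>)"
proof -
  obtain \<tau> h where r: "\<And>i. i \<in> I \<Longrightarrow> represents \<tau> (h i) (\<mu> i)"
    using common_representation[of I \<mu>] I(1) \<mu> by metis
  obtain \<sigma> k where s: "represents \<sigma> k \<rho>" using signed_measure_representation[OF \<rho>] .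
  have R: "represents \<tau> (\<lambda>x. \<Sum>i\<in>I. a i * h i x) (\<lambda>B. \<Sum>i\<in>I. a i * \<mu> i B)"
    by (rule represents_sum[OF I r])
  obtain i where i: "i \<in> I" using I by auto
  note int = kernel_integrable_density[OF r s K]
  have eq: "(\<lambda>(t, u). (\<Sum>i\<in>I. a i * h i t) * k u * kernel_on K A B t u)
      = (\<lambda>p. \<Sum>i\<in>I. a i * (case p of (t, u) \<Rightarrow> h i t * k u * kernel_on K A B t u))"
    by (auto simp: sum_distrib_right sum_distrib_left ac_simps)
  have int': "integrable (\<tau> \<Otimes>\<^sub>M \<sigma>) (\<lambda>(t, u). (\<Sum>i\<in>I. a i * h i t) * k u * kernel_on K A B t u)"
    unfolding eq using int by (intro Bochner_Integration.integrable_sum integrable_mult_right)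
  show ki: "kernel_integrable K A (\<lambda>C. \<Sum>i\<in>I. a i * \<mu> i C) B \<rho>"
    unfolding kernel_integrable_iff[OF R s kernel_integrable_measurable[OF K[OF i]]] by (rule int')
  show "kernel_integral K A (\<lambda>C. \<Sum>i\<in>I. a i * \<mu> i C) B \<rho> = (\<Sum>i\<in>I. a i * kernel_integral K A (\<mu> i) B \<rho>)"
    unfolding kernel_integral_eq(2)[OF R s ki] eq
    using int by (subst Bochner_Integration.integral_sum)
      (auto simp: kernel_integral_eq(2)[OF r s K] intro!: sum.cong)
qed

lemma kernel_sum_right:
  assumes I: "finite I" "I \<noteq> {}" and \<mu>: "signed_measure \<mu>" and \<rho>: "\<And>i. i \<in> I \<Longrightarrow> signed_measure (\<rho> i)"
    and K: "\<And>i. i \<in> I \<Longrightarrow> kernel_integrable K A \<mu> B (\<rho> i)"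
  shows "kernel_integrable K A \<mu> B (\<lambda>C. \<Sum>i\<in>I. a i * \<rho> i C)"
    and "kernel_integral K A \<mu> B (\<lambda>C. \<Sum>i\<in>I. a i * \<rho> i C) = (\<Sum>i\<in>I. a i * kernel_integral K A \<mu> B (\<rho> i))"
proof -
  obtain \<tau> h where r: "represents \<tau> h \<mu>" using signed_measure_representation[OF \<mu>] .
  obtain \<sigma> k where s: "\<And>i. i \<in> I \<Longrightarrow> represents \<sigma> (k i) (\<rho> i)"
    using common_representation[of I \<rho>] I(1) \<rho> by metis
  have R: "represents \<sigma> (\<lambda>x. \<Sum>i\<in>I. a i * k i x) (\<lambda>B. \<Sum>i\<in>I. a i * \<rho> i B)"
    by (rule represents_sum[OF I s])
  obtain i where i: "i \<in> I" using I by auto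
  note int = kernel_integrable_density[OF r s K]
  have eq: "(\<lambda>(t, u). h t * (\<Sum>i\<in>I. a i * k i u) * kernel_on K A B t u)
      = (\<lambda>p. \<Sum>i\<in>I. a i * (case p of (t, u) \<Rightarrow> h t * k i u * kernel_on K A B t u))"
    by (auto simp: sum_distrib_right sum_distrib_left ac_simps)
  have int': "integrable (\<tau> \<Otimes>\<^sub>M \<sigma>) (\<lambda>(t, u). h t * (\<Sum>i\<in>I. a i * k i u) * kernel_on K A B t u)"
    unfolding eq using int by (intro Bochner_Integration.integrable_sum integrable_mult_right)
  show ki: "kernel_integrable K A \<mu> B (\<lambda>C. \<Sum>i\<in>I. a i * \<rho> i C)"
    using int' kernel_integrable_iff[OF r R kernel_integrable_measurable[OF K[OF i]]] by simp
  show "kernel_integral K A \<mu> B (\<lambda>C. \<Sum>i\<in>I. a i * \<rho> i C) = (\<Sum>i\<in>I. a i * kernel_integral K A \<mu> B (\<rho> i))"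
    unfolding kernel_integral_eq(2)[OF r R ki] eq
    using int by (subst Bochner_Integration.integral_sum)
      (auto simp: kernel_integral_eq(2)[OF r s K] intro!: sum.cong)
qed

lemma kernel_swap:
  assumes \<mu>: "signed_measure \<mu>" and \<rho>: "signed_measure \<rho>"
    and sym: "\<And>t s. t \<in> A \<Longrightarrow> s \<in> B \<Longrightarrow> K s t = K t s"
    and K: "kernel_integrable K A \<mu> B \<rho>"
  shows "kernel_integrable K B \<rho> A \<mu>" and "kernel_integral K B \<rho> A \<mu> = kernel_integral K A \<mu> B \<rho>"
proof -
  obtain \<tau> h where r: "represents \<tau> h \<mu>" using signed_measure_representation[OF \<mu>] .
  obtain \<sigma> k where s: "represents \<sigma> k \<rho>" using signed_measure_representation[OF \<rho>] .
  interpret \<tau>: finite_measure \<tau> by (rule representsD[OF r])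
  interpret \<sigma>: finite_measure \<sigma> by (rule representsD[OF s])
  interpret pair_sigma_finite \<tau> \<sigma> ..
  have swap: "kernel_on K B A u t = kernel_on K A B t u" for t u
    using sym by (auto simp: kernel_on_def indicator_def)
  note int = kernel_integrable_density[OF r s K]
  have eq: "(\<lambda>(u, t). k u * h t * kernel_on K B A u t) =
      (\<lambda>(u, t). (case (t, u) of (t, u) \<Rightarrow> h t * k u * kernel_on K A B t u))"
    by (auto simp: swap ac_simps)
  have "(\<lambda>p. case (case p of (u, t) \<Rightarrow> (t, u)) of (t, u) \<Rightarrow> kernel_on K A B t u) \<in> borel_measurable (borel \<Otimes>\<^sub>M borel)"
    using measurable_compose[OF measurable_pair_swap' kernel_integrable_measurable[OF K]] by simp
  also have "(\<lambda>p. case (case p of (u, t) \<Rightarrow> (t, u)) of (t, u) \<Rightarrow> kernel_on K A B t u) = (\<lambda>(u, t). kernel_on K B A u t)"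
    by (auto simp: swap)
  finally have m: "(\<lambda>(u, t). kernel_on K B A u t) \<in> borel_measurable (borel \<Otimes>\<^sub>M borel)" .
  show ki: "kernel_integrable K B \<rho> A \<mu>"
    unfolding kernel_integrable_iff[OF s r m] eq by (rule integrable_product_swap[OF int])
  show "kernel_integral K B \<rho> A \<mu> = kernel_integral K A \<mu> B \<rho>"
    unfolding kernel_integral_eq(2)[OF s r ki] kernel_integral_eq(2)[OF r s K] eq
    by (rule integral_product_swap) (use int in auto)
qed

section \<open>Point masses\<close>

lemma signed_measure_point_mass: "signed_measure (point_mass t)"
  by (rule signed_measure_if_represents[OF represents_point_mass])

lemma signed_integral_point_mass:
  assumes t: "t \<in> A" and g: "set_borel_measurable borel A g"
  shows "signed_integrable (point_mass t) A g" "signed_integral (point_mass t) A g = g t"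
proof -
  have [measurable]: "(\<lambda>x. indicator A x *\<^sub>R g x) \<in> borel_measurable borel"
    using g by (simp add: set_borel_measurable_def)
  show si: "signed_integrable (point_mass t) A g"
    unfolding signed_integrable_iff[OF represents_point_mass g]
  proof (rule integrableI_bounded)
    show "(\<integral>\<^sup>+x. norm (1 *\<^sub>R indicat_real A x *\<^sub>R g x) \<partial>return borel t) < \<infinity>"
      by (subst nn_integral_return) (simp_all del: norm_scaleR)
  qed simp
  show "signed_integral (point_mass t) A g = g t"
    unfolding signed_integral_eq[OF represents_point_mass si]
    using t by (subst integral_return) auto
qed

lemma kernel_section_measurable:
  assumes K: "(\<lambda>(t, s). kernel_on K A B t s) \<in> borel_measurable (borel \<Otimes>\<^sub>M borel)"
  shows "t \<in> A \<Longrightarrow> set_borel_measurable borel B (K t)"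
    and "s \<in> B \<Longrightarrow> set_borel_measurable borel A (\<lambda>t. K t s)"
  using measurable_compose[OF measurable_Pair1' K, of t] measurable_compose[OF measurable_Pair2' K, of s]
  by (auto simp: set_borel_measurable_def kernel_on_def mult.commute mult.left_commute)

text \<open>Integrating out the point mass leaves the section of K at t. In this way an identity
  between kernel integrals, tested on point masses, becomes a pointwise identity for the potential
  of \<mu>.\<close>

lemma kernel_point_mass:
  assumes \<mu>: "signed_measure \<mu>" and t: "t \<in> B"
    and K: "(\<lambda>(s, t). kernel_on K A B s t) \<in> borel_measurable (borel \<Otimes>\<^sub>M borel)"
    and int: "signed_integrable \<mu> A (\<lambda>s. K s t)"
  shows "kernel_integrable K A \<mu> B (point_mass t)"
    and "kernel_integral K A \<mu> B (point_mass t) = signed_integral \<mu> A (\<lambda>s. K s t)"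
proof -
  obtain \<tau> h where r: "represents \<tau> h \<mu>" using signed_measure_representation[OF \<mu>] .
  note D = representsD[OF r]
  note P = represents_point_mass[of t]
  interpret \<tau>: finite_measure \<tau> by (rule D)
  interpret \<sigma>: prob_space "return borel t" by (rule prob_space_return) simp
  interpret pair_sigma_finite \<tau> "return borel t" ..
  note kint = signed_integrable_density[OF r int]
  have [measurable]: "h \<in> borel_measurable \<tau>" using D(4) by auto
  have sets: "sets (\<tau> \<Otimes>\<^sub>M return borel t) = sets (borel \<Otimes>\<^sub>M borel)"
    by (rule sets_pair_measure_cong) (auto simp: D(2))
  have [measurable]: "(\<lambda>(s, t). kernel_on K A B s t) \<in> borel_measurable (\<tau> \<Otimes>\<^sub>M return borel t)"
    using K measurable_cong_sets[OF sets refl] by blast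
  have [measurable]: "(\<lambda>u. kernel_on K A B s u) \<in> borel_measurable borel" for s
    using measurable_compose[OF measurable_Pair1' K, of s] by simp
  have m: "(\<lambda>(s, u). h s * 1 * kernel_on K A B s u) \<in> borel_measurable (\<tau> \<Otimes>\<^sub>M return borel t)"
    by measurable
  show "kernel_integrable K A \<mu> B (point_mass t)"
    unfolding kernel_integrable_iff[OF r P K]
  proof (rule Fubini_integrable[OF m])
    have "(LINT u|return borel t. norm (case (s, u) of (s, u) \<Rightarrow> h s * 1 * kernel_on K A B s u))
        = norm (h s *\<^sub>R (indicator A s *\<^sub>R K s t))" for s
    proof -
      have "(LINT u|return borel t. norm (h s * 1 * kernel_on K A B s u)) = norm (h s * 1 * kernel_on K A B s t)"
        by (subst integral_return) auto
      then show ?thesis using t by (simp add: kernel_on_def)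
    qed
    then have "(\<lambda>s. LINT u|return borel t. norm (case (s, u) of (s, u) \<Rightarrow> h s * 1 * kernel_on K A B s u))
        = (\<lambda>s. norm (h s *\<^sub>R (indicator A s *\<^sub>R K s t)))" by blast
    then show "integrable \<tau> (\<lambda>s. LINT u|return borel t. norm (case (s, u) of (s, u) \<Rightarrow> h s * 1 * kernel_on K A B s u))"
      using kint by (simp only: integrable_norm)
    have "integrable (return borel t) (\<lambda>u. h s * kernel_on K A B s u)" for s
    proof (rule integrableI_bounded)
      show "(\<integral>\<^sup>+u. norm (h s * kernel_on K A B s u) \<partial>return borel t) < \<infinity>"
        by (subst nn_integral_return) auto
    qed auto
    then show "AE s in \<tau>. integrable (return borel t) (\<lambda>u. case (s, u) of (s, u) \<Rightarrow> h s * 1 * kernel_on K A B s u)"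
      by simp
  qed
  show "kernel_integral K A \<mu> B (point_mass t) = signed_integral \<mu> A (\<lambda>s. K s t)"
    unfolding kernel_integral_def
    by (intro signed_integral_cong signed_integral_point_mass(2) t kernel_section_measurable(1)[OF K])
qed

section \<open>Restriction to Borel sets and truncation\<close>

lemma signed_measure_restrict:
  assumes "signed_measure \<mu>" "A \<in> sets borel"
  shows "signed_measure (\<lambda>B. \<mu> (B \<inter> A))"
  using signed_measure_representation[OF assms(1)] represents_restrict[OF _ assms(2)]
    signed_measure_if_represents by metis

lemma signed_integrable_restrict:
  assumes \<mu>: "signed_measure \<mu>" and A: "A \<in> sets borel" and g: "signed_integrable \<mu> T g"
  shows "signed_integrable (\<lambda>B. \<mu> (B \<inter> A)) T g"
proof -
  obtain \<tau> h where r: "represents \<tau> h \<mu>" using signed_measure_representation[OF \<mu>] .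
  have "integrable \<tau> (\<lambda>x. indicator A x *\<^sub>R (h x *\<^sub>R (indicator T x *\<^sub>R g x)))"
    using A representsD(2)[OF r] by (intro integrable_mult_indicator signed_integrable_density[OF r g]) simp
  then show ?thesis
    by (subst signed_integrable_iff[OF represents_restrict[OF r A] signed_integrable_measurable[OF g]])
      (simp add: mult.assoc)
qed

lemma signed_integral_restrict_tendsto:
  assumes \<mu>: "signed_measure \<mu>" and A: "\<And>n. A n \<in> sets borel" and g: "signed_integrable \<mu> T g"
    and ev: "\<And>x. x \<in> T \<Longrightarrow> eventually (\<lambda>n. x \<in> A n) sequentially"
  shows "(\<lambda>n. signed_integral (\<lambda>B. \<mu> (B \<inter> A n)) T g) \<longlonglongrightarrow> signed_integral \<mu> T g"
proof -
  obtain \<tau> h where r: "represents \<tau> h \<mu>" using signed_measure_representation[OF \<mu>] .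
  note int = signed_integrable_density[OF r g]
  let ?F = "\<lambda>x. h x *\<^sub>R (indicator T x *\<^sub>R g x)"
  have m: "?F \<in> borel_measurable \<tau>" using int by (rule borel_measurable_integrable)
  have "(\<lambda>n. LINT x|\<tau>. indicator (A n) x *\<^sub>R ?F x) \<longlonglongrightarrow> (LINT x|\<tau>. ?F x)"
  proof (rule integral_dominated_convergence[where w="\<lambda>x. norm (?F x)"])
    show "(\<lambda>x. indicator (A n) x *\<^sub>R ?F x) \<in> borel_measurable \<tau>" for n
      using A representsD(2)[OF r] by (intro borel_measurable_scaleR m) auto
    show "AE x in \<tau>. (\<lambda>n. indicator (A n) x *\<^sub>R ?F x) \<longlonglongrightarrow> ?F x"
    proof (intro AE_I2 tendsto_eventually)
      fix x
      show "eventually (\<lambda>n. indicator (A n) x *\<^sub>R ?F x = ?F x) sequentially"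
      proof (cases "x \<in> T")
        case True
        from ev[OF this] show ?thesis by eventually_elim simp
      qed simp
    qed
    show "integrable \<tau> (\<lambda>x. norm (?F x))" using int by (rule integrable_norm)
    show "AE x in \<tau>. norm (indicator (A n) x *\<^sub>R ?F x) \<le> norm (?F x)" for n
      by (intro AE_I2) (auto simp: indicator_def)
  qed (rule m)
  moreover have "signed_integral (\<lambda>B. \<mu> (B \<inter> A n)) T g = (LINT x|\<tau>. indicator (A n) x *\<^sub>R ?F x)" for n
    by (subst signed_integral_eq[OF represents_restrict[OF r A] signed_integrable_restrict[OF \<mu> A g]])
      (simp add: mult.assoc)
  ultimately show ?thesis by (simp add: signed_integral_eq[OF r g])
qed

text \<open>Dominated convergence with the untruncated integrand as bound. Each factor has its own
  sequence of sets, so that the constant sequence \<open>UNIV\<close> leaves one of them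
  intact.\<close>

lemma kernel_restrict:
  assumes \<mu>: "signed_measure \<mu>" and \<rho>: "signed_measure \<rho>"
    and C: "\<And>n. C n \<in> sets borel" "\<And>n. D n \<in> sets borel" and K: "kernel_integrable K A \<mu> B \<rho>"
  shows "kernel_integrable K A (\<lambda>E. \<mu> (E \<inter> C n)) B (\<lambda>E. \<rho> (E \<inter> D n))"
    and "\<lbrakk>\<And>x. x \<in> A \<Longrightarrow> eventually (\<lambda>n. x \<in> C n) sequentially;
      \<And>x. x \<in> B \<Longrightarrow> eventually (\<lambda>n. x \<in> D n) sequentially\<rbrakk> \<Longrightarrow>
      (\<lambda>n. kernel_integral K A (\<lambda>E. \<mu> (E \<inter> C n)) B (\<lambda>E. \<rho> (E \<inter> D n))) \<longlonglongrightarrow> kernel_integral K A \<mu> B \<rho>"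
proof -
  obtain \<tau> h where r: "represents \<tau> h \<mu>" using signed_measure_representation[OF \<mu>] .
  obtain \<sigma> k where s: "represents \<sigma> k \<rho>" using signed_measure_representation[OF \<rho>] .
  note R = represents_restrict[OF r C(1)] and S = represents_restrict[OF s C(2)]
  note int = kernel_integrable_density[OF r s K]
  let ?F = "\<lambda>(t, u). h t * k u * kernel_on K A B t u"
  have eq: "(\<lambda>(t, u). indicator (C n) t * h t * (indicator (D n) u * k u) * kernel_on K A B t u)
      = (\<lambda>p. indicator (C n \<times> D n) p *\<^sub>R ?F p)" for n
    by (auto simp: indicator_def)
  have CD: "C n \<times> D n \<in> sets (\<tau> \<Otimes>\<^sub>M \<sigma>)" for n
    using C representsD(2)[OF r] representsD(2)[OF s] by auto
  show ki: "kernel_integrable K A (\<lambda>E. \<mu> (E \<inter> C n)) B (\<lambda>E. \<rho> (E \<inter> D n))" for n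
    unfolding kernel_integrable_iff[OF R S kernel_integrable_measurable[OF K]] eq
    by (intro integrable_mult_indicator CD int)
  assume ev: "\<And>x. x \<in> A \<Longrightarrow> eventually (\<lambda>n. x \<in> C n) sequentially"
    "\<And>x. x \<in> B \<Longrightarrow> eventually (\<lambda>n. x \<in> D n) sequentially"
  have "(\<lambda>n. LINT p|(\<tau> \<Otimes>\<^sub>M \<sigma>). indicator (C n \<times> D n) p *\<^sub>R ?F p) \<longlonglongrightarrow> (LINT p|(\<tau> \<Otimes>\<^sub>M \<sigma>). ?F p)"
  proof (rule integral_dominated_convergence[where w="\<lambda>p. norm (?F p)"])
    have m: "?F \<in> borel_measurable (\<tau> \<Otimes>\<^sub>M \<sigma>)" using int by (rule borel_measurable_integrable)
    then show "?F \<in> borel_measurable (\<tau> \<Otimes>\<^sub>M \<sigma>)" .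
    show "(\<lambda>p. indicator (C n \<times> D n) p *\<^sub>R ?F p) \<in> borel_measurable (\<tau> \<Otimes>\<^sub>M \<sigma>)" for n
      using CD by (intro borel_measurable_scaleR m) auto
    show "AE p in \<tau> \<Otimes>\<^sub>M \<sigma>. (\<lambda>n. indicator (C n \<times> D n) p *\<^sub>R ?F p) \<longlonglongrightarrow> ?F p"
    proof (intro AE_I2 tendsto_eventually)
      fix p :: "'a \<times> 'a"
      obtain t u where p: "p = (t, u)" by (cases p)
      show "eventually (\<lambda>n. indicator (C n \<times> D n) p *\<^sub>R ?F p = ?F p) sequentially"
      proof (cases "t \<in> A \<and> u \<in> B")
        case True
        with ev have "eventually (\<lambda>n. t \<in> C n) sequentially" "eventually (\<lambda>n. u \<in> D n) sequentially"
          by auto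
        then show ?thesis by eventually_elim (simp add: p)
      qed (auto simp: p kernel_on_def)
    qed
    show "integrable (\<tau> \<Otimes>\<^sub>M \<sigma>) (\<lambda>p. norm (?F p))" using int by (rule integrable_norm)
    show "AE p in \<tau> \<Otimes>\<^sub>M \<sigma>. norm (indicator (C n \<times> D n) p *\<^sub>R ?F p) \<le> norm (?F p)" for n
      by (auto simp: indicator_def)
  qed
  then show "(\<lambda>n. kernel_integral K A (\<lambda>E. \<mu> (E \<inter> C n)) B (\<lambda>E. \<rho> (E \<inter> D n))) \<longlonglongrightarrow> kernel_integral K A \<mu> B \<rho>"
    unfolding kernel_integral_eq(2)[OF R S ki] kernel_integral_eq(2)[OF r s K] eq .
qed

text \<open>The set \<open>C n\<close> consists of the points where the absolute potential \<phi> of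
  \<rho> is at most n. By \<open>int\<close> these sets exhaust A, and on each of them the absolute
  double integral is at most n times the total variation of \<mu>.\<close>

lemma kernel_truncation:
  assumes \<mu>: "signed_measure \<mu>" and \<rho>: "signed_measure \<rho>"
    and K: "(\<lambda>(t, s). kernel_on K A B t s) \<in> borel_measurable (borel \<Otimes>\<^sub>M borel)"
    and int: "\<And>t. t \<in> A \<Longrightarrow> signed_integrable \<rho> B (K t)"
  obtains C :: "nat \<Rightarrow> 'a::topological_space set" where "\<And>n. C n \<in> sets borel"
    "\<And>t. t \<in> A \<Longrightarrow> eventually (\<lambda>n. t \<in> C n) sequentially"
    "\<And>n. kernel_integrable K A (\<lambda>E. \<mu> (E \<inter> C n)) B \<rho>"
proof -
  obtain \<tau> h where r: "represents \<tau> h \<mu>" using signed_measure_representation[OF \<mu>] .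
  obtain \<sigma> k where s: "represents \<sigma> k \<rho>" using signed_measure_representation[OF \<rho>] .
  note D = representsD[OF r] and D' = representsD[OF s]
  interpret \<tau>: finite_measure \<tau> by (rule D)
  interpret \<sigma>: finite_measure \<sigma> by (rule D')
  have [measurable]: "h \<in> borel_measurable \<tau>" "k \<in> borel_measurable \<sigma>" using D(4) D'(4) by auto
  have [measurable]: "(\<lambda>(s, t). kernel_on K A B s t) \<in> borel_measurable (\<tau> \<Otimes>\<^sub>M \<sigma>)"
    using K measurable_cong_sets[OF sets_pair_measure_cong[OF D(2) D'(2)] refl] by blast
  define \<phi> where "\<phi> t = (\<integral>\<^sup>+u. ennreal (norm (k u * kernel_on K A B t u)) \<partial>\<sigma>)" for t
  have [measurable]: "\<phi> \<in> borel_measurable \<tau>"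
    unfolding \<phi>_def by measurable
  define C where "C n = {t. \<phi> t \<le> of_nat n}" for n :: nat
  show thesis
  proof
    have "C n = {t \<in> space \<tau>. \<phi> t \<le> of_nat n}" for n
      using D(3) by (auto simp: C_def)
    then have C: "C n \<in> sets \<tau>" for n by simp
    then show C': "C n \<in> sets borel" for n using D(2) by simp
    show "eventually (\<lambda>n. t \<in> C n) sequentially" if t: "t \<in> A" for t
    proof -
      have "integrable \<sigma> (\<lambda>u. k u * kernel_on K A B t u)"
        using signed_integrable_density[OF s int[OF t]] t by (simp add: kernel_on_def)
      then have "\<phi> t < \<infinity>" by (simp add: \<phi>_def integrable_iff_bounded)
      then obtain N :: nat where "\<phi> t < of_nat N"
        by (metis ennreal_Ex_less_of_nat infinity_ennreal_def)
      then have "\<phi> t \<le> of_nat n" if "N \<le> n" for n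
        using that by (meson le_less_trans less_imp_le of_nat_mono order_trans)
      then show ?thesis by (auto simp: eventually_sequentially C_def)
    qed
    show "kernel_integrable K A (\<lambda>E. \<mu> (E \<inter> C n)) B \<rho>" for n
      unfolding kernel_integrable_iff[OF represents_restrict[OF r C'] s K]
    proof (rule integrableI_bounded)
      show "(\<lambda>(t, u). indicator (C n) t * h t * k u * kernel_on K A B t u) \<in> borel_measurable (\<tau> \<Otimes>\<^sub>M \<sigma>)"
        using C[measurable] by measurable
      then have "(\<integral>\<^sup>+p. norm (case p of (t, u) \<Rightarrow> indicator (C n) t * h t * k u * kernel_on K A B t u) \<partial>(\<tau> \<Otimes>\<^sub>M \<sigma>))
          = (\<integral>\<^sup>+t. \<integral>\<^sup>+u. norm (indicator (C n) t * h t * k u * kernel_on K A B t u) \<partial>\<sigma> \<partial>\<tau>)"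
        by (subst \<sigma>.nn_integral_fst[symmetric]) auto
      also have "\<dots> \<le> (\<integral>\<^sup>+t. ennreal (norm (h t)) * of_nat n \<partial>\<tau>)"
      proof (rule nn_integral_mono)
        fix t
        have "(\<lambda>u. kernel_on K A B t u) \<in> borel_measurable \<sigma>"
          using measurable_compose[OF measurable_Pair1' K, of t]
          by (simp add: measurable_represents[OF s])
        then have "(\<integral>\<^sup>+u. norm (indicator (C n) t * h t * k u * kernel_on K A B t u) \<partial>\<sigma>)
            = ennreal (norm (indicator (C n) t * h t)) * \<phi> t"
          unfolding \<phi>_def
          by (subst nn_integral_cmult[symmetric]) (auto simp: ennreal_mult[symmetric] abs_mult mult.assoc)
        also have "\<dots> \<le> ennreal (norm (h t)) * of_nat n"
          by (cases "t \<in> C n") (auto simp: C_def intro: mult_left_mono)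
        finally show "(\<integral>\<^sup>+u. norm (indicator (C n) t * h t * k u * kernel_on K A B t u) \<partial>\<sigma>) \<le> ennreal (norm (h t)) * of_nat n" .
      qed
      also have "\<dots> = (\<integral>\<^sup>+t. ennreal (norm (h t)) \<partial>\<tau>) * of_nat n"
        by (rule nn_integral_multc) auto
      also have "\<dots> < \<infinity>"
        using D(4) by (simp add: integrable_iff_bounded ennreal_mult_less_top of_nat_less_top)
      finally show "(\<integral>\<^sup>+p. norm (case p of (t, u) \<Rightarrow> indicator (C n) t * h t * k u * kernel_on K A B t u) \<partial>(\<tau> \<Otimes>\<^sub>M \<sigma>)) < \<infinity>" .
    qed
  qed
qed

section \<open>Covariances of square-integrable random variables\<close>

definition square_integrable :: "'w measure \<Rightarrow> ('w \<Rightarrow> real) \<Rightarrow> bool" where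
  "square_integrable M X \<longleftrightarrow> X \<in> borel_measurable M \<and> integrable M (\<lambda>\<omega>. (X \<omega>)\<^sup>2)"

lemma square_integrable_mult:
  assumes "square_integrable M X" "square_integrable M Y"
  shows "integrable M (\<lambda>\<omega>. X \<omega> * Y \<omega>)"
proof (rule Bochner_Integration.integrable_bound)
  show "integrable M (\<lambda>\<omega>. (X \<omega>)\<^sup>2 + (Y \<omega>)\<^sup>2)" "(\<lambda>\<omega>. X \<omega> * Y \<omega>) \<in> borel_measurable M"
    using assms by (auto simp: square_integrable_def)
  have "\<bar>a * b\<bar> \<le> \<bar>a\<^sup>2 + b\<^sup>2\<bar>" for a b :: real
  proof -
    have "0 \<le> (\<bar>a\<bar> - \<bar>b\<bar>)\<^sup>2" by simp
    then have "2 * (\<bar>a\<bar> * \<bar>b\<bar>) \<le> a\<^sup>2 + b\<^sup>2" by (simp add: power2_diff)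
    moreover have "0 \<le> \<bar>a\<bar> * \<bar>b\<bar>" by simp
    ultimately have "\<bar>a\<bar> * \<bar>b\<bar> \<le> a\<^sup>2 + b\<^sup>2" by linarith
    then show ?thesis by (simp add: abs_mult)
  qed
  then show "AE \<omega> in M. norm (X \<omega> * Y \<omega>) \<le> norm ((X \<omega>)\<^sup>2 + (Y \<omega>)\<^sup>2)"
    by simp
qed

lemma square_integrable_lincomb:
  assumes "square_integrable M X" "square_integrable M Y"
  shows "square_integrable M (\<lambda>\<omega>. a * X \<omega> + b * Y \<omega>)"
proof -
  have "integrable M (\<lambda>\<omega>. a\<^sup>2 * (X \<omega>)\<^sup>2 + 2 * a * b * (X \<omega> * Y \<omega>) + b\<^sup>2 * (Y \<omega>)\<^sup>2)"
    using assms square_integrable_mult[OF assms] by (auto simp: square_integrable_def)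
  also have "(\<lambda>\<omega>. a\<^sup>2 * (X \<omega>)\<^sup>2 + 2 * a * b * (X \<omega> * Y \<omega>) + b\<^sup>2 * (Y \<omega>)\<^sup>2) = (\<lambda>\<omega>. (a * X \<omega> + b * Y \<omega>)\<^sup>2)"
    by (auto simp: power2_sum power_mult_distrib ac_simps)
  finally show ?thesis using assms by (auto simp: square_integrable_def)
qed

lemma covariance_commute: "covariance M X Y = covariance M Y X"
  by (simp add: covariance_def mult.commute)

context prob_space
begin

lemma square_integrable_integrable:
  assumes "square_integrable M X"
  shows "integrable M X"
proof -
  have "square_integrable M (\<lambda>_. 1)" by (simp add: square_integrable_def)
  from square_integrable_mult[OF assms this] show ?thesis by simp
qed

lemma covariance_eq:
  assumes "square_integrable M X" "square_integrable M Y"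
  shows "covariance M X Y = expectation (\<lambda>\<omega>. X \<omega> * Y \<omega>) - expectation X * expectation Y"
proof -
  note int = square_integrable_integrable[OF assms(1)] square_integrable_integrable[OF assms(2)]
    square_integrable_mult[OF assms]
  have "covariance M X Y = expectation (\<lambda>\<omega>. X \<omega> * Y \<omega> - expectation Y * X \<omega> - expectation X * Y \<omega>
      + expectation X * expectation Y)"
    unfolding covariance_def by (intro Bochner_Integration.integral_cong) (auto simp: algebra_simps)
  also have "\<dots> = expectation (\<lambda>\<omega>. X \<omega> * Y \<omega>) - expectation X * expectation Y"
    using int by (simp add: prob_space)
  finally show ?thesis .
qed

lemma covariance_lincomb_left:
  assumes "square_integrable M X" "square_integrable M Y" "square_integrable M Z"
  shows "covariance M (\<lambda>\<omega>. a * X \<omega> + b * Y \<omega>) Z = a * covariance M X Z + b * covariance M Y Z"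
proof -
  note int = square_integrable_integrable[OF assms(1)] square_integrable_integrable[OF assms(2)]
    square_integrable_mult[OF assms(1,3)] square_integrable_mult[OF assms(2,3)]
  have "expectation (\<lambda>\<omega>. (a * X \<omega> + b * Y \<omega>) * Z \<omega>)
      = expectation (\<lambda>\<omega>. a * (X \<omega> * Z \<omega>) + b * (Y \<omega> * Z \<omega>))"
    by (simp add: algebra_simps)
  with int show ?thesis
    using assms by (simp add: covariance_eq square_integrable_lincomb algebra_simps)
qed

lemma covariance_nonneg: "0 \<le> covariance M X X"
  by (simp add: covariance_def)

lemma covariance_quadratic:
  assumes "square_integrable M X" "square_integrable M Y"
  shows "covariance M (\<lambda>\<omega>. a * X \<omega> + b * Y \<omega>) (\<lambda>\<omega>. a * X \<omega> + b * Y \<omega>)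
    = a\<^sup>2 * covariance M X X + 2 * a * b * covariance M X Y + b\<^sup>2 * covariance M Y Y"
proof -
  let ?Z = "\<lambda>\<omega>. a * X \<omega> + b * Y \<omega>"
  have "covariance M ?Z ?Z = a * covariance M ?Z X + b * covariance M ?Z Y"
    unfolding covariance_lincomb_left[OF assms square_integrable_lincomb[OF assms]]
    by (simp only: covariance_commute[of M _ ?Z])
  also have "\<dots> = a * (a * covariance M X X + b * covariance M X Y) + b * (a * covariance M X Y + b * covariance M Y Y)"
    unfolding covariance_lincomb_left[OF assms assms(1)] covariance_lincomb_left[OF assms assms(2)]
    by (simp only: covariance_commute[of M Y X])
  finally show ?thesis by (simp add: algebra_simps power2_eq_square)
qed

lemma covariance_Cauchy_Schwarz:
  assumes "square_integrable M X" "square_integrable M Y"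
  shows "(covariance M X Y)\<^sup>2 \<le> covariance M X X * covariance M Y Y"
proof -
  let ?a = "covariance M X X" and ?b = "covariance M X Y" and ?c = "covariance M Y Y"
  have quad: "0 \<le> s\<^sup>2 * ?a + 2 * s * t * ?b + t\<^sup>2 * ?c" for s t
    using covariance_nonneg[of "\<lambda>\<omega>. s * X \<omega> + t * Y \<omega>"] covariance_quadratic[OF assms, of s t] by simp
  show ?thesis
  proof (cases "?c = 0")
    case True
    have "?b = 0"
    proof (rule ccontr)
      assume b: "?b \<noteq> 0"
      \<comment> \<open>With \<open>?c = 0\<close> the quadratic form is affine in t once s = 1;
        this t is the point where its value is -1.\<close>
      have "0 \<le> ?a + 2 * (- (?a + 1) / (2 * ?b)) * ?b"
        using quad[of 1 "- (?a + 1) / (2 * ?b)"] True by simp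
      also have "\<dots> = -1" using b by (simp add: field_simps)
      finally show False by simp
    qed
    then show ?thesis using True by simp
  next
    case False
    then have c: "0 < ?c" using covariance_nonneg[of Y] by simp
    \<comment> \<open>For s = 1 the form is minimal at t = -?b / ?c; the pair is scaled by
      \<open>?c\<close> to avoid the division.\<close>
    have "0 \<le> ?c\<^sup>2 * ?a + 2 * ?c * (- ?b) * ?b + (- ?b)\<^sup>2 * ?c" by (rule quad)
    also have "\<dots> = ?c * (?a * ?c - ?b\<^sup>2)" by (simp add: algebra_simps power2_eq_square)
    finally show ?thesis using c by (simp add: zero_le_mult_iff)
  qed
qed

text \<open>Since the means agree, the mean squared error is the variance of Z - X.\<close>

lemma mse_eq_covariance:
  assumes "square_integrable M X" "square_integrable M Z" "expectation X = expectation Z"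
  shows "mse M Z X = covariance M Z Z - 2 * covariance M Z X + covariance M X X"
proof -
  have "mse M Z X = covariance M (\<lambda>\<omega>. 1 * Z \<omega> + (-1) * X \<omega>) (\<lambda>\<omega>. 1 * Z \<omega> + (-1) * X \<omega>)"
    using assms square_integrable_integrable[of X] square_integrable_integrable[of Z]
    by (simp add: mse_def covariance_def power2_eq_square)
  then show ?thesis using covariance_quadratic[OF assms(2,1), of 1 "-1"] by simp
qed

text \<open>The two limits together say that the variance of \<open>Xn n\<close> - X tends to 0, and
  Cauchy-Schwarz then bounds its covariance with Y. Nothing has to be known beforehand about the
  covariances with Y.\<close>

lemma covariance_tendsto:
  assumes X: "square_integrable M X" and Y: "square_integrable M Y"
    and Xn: "\<And>n :: nat. square_integrable M (Xn n)"
    and lim: "(\<lambda>n. covariance M (Xn n) (Xn n)) \<longlonglongrightarrow> covariance M X X"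
      "(\<lambda>n. covariance M (Xn n) X) \<longlonglongrightarrow> covariance M X X"
  shows "(\<lambda>n. covariance M (Xn n) Y) \<longlonglongrightarrow> covariance M X Y"
proof -
  let ?d = "\<lambda>n \<omega>. 1 * Xn n \<omega> + (-1) * X \<omega>"
  have "(\<lambda>n. covariance M (Xn n) (Xn n) - 2 * covariance M (Xn n) X + covariance M X X)
      \<longlonglongrightarrow> covariance M X X - 2 * covariance M X X + covariance M X X"
    by (intro tendsto_intros lim)
  then have "(\<lambda>n. covariance M (?d n) (?d n)) \<longlonglongrightarrow> 0"
    using covariance_quadratic[OF Xn X, where a=1 and b="-1"] by simp
  then have "(\<lambda>n. sqrt (covariance M (?d n) (?d n) * covariance M Y Y)) \<longlonglongrightarrow> sqrt (0 * covariance M Y Y)"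
    by (intro tendsto_intros)
  then have "(\<lambda>n. sqrt (covariance M (?d n) (?d n) * covariance M Y Y)) \<longlonglongrightarrow> 0"
    by simp
  then have "(\<lambda>n. covariance M (?d n) Y) \<longlonglongrightarrow> 0"
  proof (rule Lim_null_comparison[rotated])
    show "\<forall>\<^sub>F n in sequentially. norm (covariance M (?d n) Y) \<le> sqrt (covariance M (?d n) (?d n) * covariance M Y Y)"
      using covariance_Cauchy_Schwarz[OF square_integrable_lincomb[OF Xn X] Y]
      by (intro always_eventually allI) (simp only: real_norm_def real_le_rsqrt power2_abs)
  qed
  moreover have "covariance M (?d n) Y = covariance M (Xn n) Y - covariance M X Y" for n
    using covariance_lincomb_left[OF Xn X Y, where a=1 and b="-1"] by simp
  ultimately show ?thesis by (simp add: LIM_zero_iff)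
qed

end

section \<open>Best linear unbiased estimation and prediction\<close>

text \<open>It makes \<open>S\<close> a Borel set, as the rules for \<open>J\<close> require of a
  set that carries a measure.\<close>

lemma closed_signed_support: "closed (signed_support \<mu>)"
proof -
  have "- signed_support \<mu> = \<Union>{U. open U \<and> (\<forall>B\<in>sets borel. B \<subseteq> U \<longrightarrow> \<mu> B = 0)}"
    by (auto simp: signed_support_def)
  then show ?thesis by (simp add: closed_def open_Union)
qed

lemma sum_UNIV_option: "(\<Sum>i\<in>UNIV. F i) = F None + (\<Sum>i\<in>UNIV. F (Some i))"
  for F :: "'i::finite option \<Rightarrow> 'b::comm_monoid_add"
  by (simp add: UNIV_option_conv sum.reindex)

section \<open>Closure properties of the admissible measures\<close>

lemma admissibleD:
  assumes "admissible f K A Q"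
  shows "signed_measure Q" "concentrated_on Q A" "signed_integrable Q A f" "kernel_integrable K A Q A Q"
  using assms by (auto simp: admissible_def)

lemma admissible_sum:
  assumes I: "finite I" "I \<noteq> {}" and \<mu>: "\<And>i. i \<in> I \<Longrightarrow> admissible f K A (\<mu> i)"
    and K: "\<And>i j. i \<in> I \<Longrightarrow> j \<in> I \<Longrightarrow> kernel_integrable K A (\<mu> i) A (\<mu> j)"
  shows "admissible f K A (\<lambda>B. \<Sum>i\<in>I. a i * \<mu> i B)"
  unfolding admissible_def
proof (intro conjI)
  note D = admissibleD[OF \<mu>]
  show sm: "signed_measure (\<lambda>B. \<Sum>i\<in>I. a i * \<mu> i B)"
    using I D(1) by (rule signed_measure_sum)
  show "concentrated_on (\<lambda>B. \<Sum>i\<in>I. a i * \<mu> i B) A"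
    using D(2) by (auto simp: concentrated_on_def)
  show "signed_integrable (\<lambda>B. \<Sum>i\<in>I. a i * \<mu> i B) A f"
    using I D(1,3) by (rule signed_integral_sum)
  show "kernel_integrable K A (\<lambda>B. \<Sum>i\<in>I. a i * \<mu> i B) A (\<lambda>B. \<Sum>i\<in>I. a i * \<mu> i B)"
    using I D(1) sm kernel_sum_right(1)[OF I D(1) D(1) K] by (rule kernel_sum_left)
qed

lemma kernel_integral_sum:
  assumes I: "finite I" "I \<noteq> {}" and I': "finite I'" "I' \<noteq> {}"
    and \<mu>: "\<And>i. i \<in> I \<Longrightarrow> signed_measure (\<mu> i)" and \<rho>: "\<And>i. i \<in> I' \<Longrightarrow> signed_measure (\<rho> i)"
    and K: "\<And>i j. i \<in> I \<Longrightarrow> j \<in> I' \<Longrightarrow> kernel_integrable K A (\<mu> i) B (\<rho> j)"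
  shows "kernel_integrable K A (\<lambda>C. \<Sum>i\<in>I. a i * \<mu> i C) B (\<lambda>C. \<Sum>i\<in>I'. b i * \<rho> i C)"
    and "kernel_integral K A (\<lambda>C. \<Sum>i\<in>I. a i * \<mu> i C) B (\<lambda>C. \<Sum>i\<in>I'. b i * \<rho> i C)
      = (\<Sum>i\<in>I. \<Sum>j\<in>I'. a i * b j * kernel_integral K A (\<mu> i) B (\<rho> j))"
proof -
  have sm: "signed_measure (\<lambda>C. \<Sum>i\<in>I'. b i * \<rho> i C)"
    using I' \<rho> by (rule signed_measure_sum)
  have r: "kernel_integrable K A (\<mu> i) B (\<lambda>C. \<Sum>i\<in>I'. b i * \<rho> i C)"
    "kernel_integral K A (\<mu> i) B (\<lambda>C. \<Sum>i\<in>I'. b i * \<rho> i C) = (\<Sum>j\<in>I'. b j * kernel_integral K A (\<mu> i) B (\<rho> j))"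
    if "i \<in> I" for i
    using kernel_sum_right[OF I' \<mu>[OF that] \<rho> K[OF that]] by auto
  show "kernel_integrable K A (\<lambda>C. \<Sum>i\<in>I. a i * \<mu> i C) B (\<lambda>C. \<Sum>i\<in>I'. b i * \<rho> i C)"
    by (rule kernel_sum_left(1)[OF I \<mu> sm r(1)])
  have "kernel_integral K A (\<lambda>C. \<Sum>i\<in>I. a i * \<mu> i C) B (\<lambda>C. \<Sum>i\<in>I'. b i * \<rho> i C)
      = (\<Sum>i\<in>I. a i * kernel_integral K A (\<mu> i) B (\<lambda>C. \<Sum>i\<in>I'. b i * \<rho> i C))"
    by (rule kernel_sum_left(2)[OF I \<mu> sm r(1)])
  also have "\<dots> = (\<Sum>i\<in>I. \<Sum>j\<in>I'. a i * b j * kernel_integral K A (\<mu> i) B (\<rho> j))"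
    by (intro sum.cong refl) (simp add: r(2) sum_distrib_left mult.assoc)
  finally show "kernel_integral K A (\<lambda>C. \<Sum>i\<in>I. a i * \<mu> i C) B (\<lambda>C. \<Sum>i\<in>I'. b i * \<rho> i C)
      = (\<Sum>i\<in>I. \<Sum>j\<in>I'. a i * b j * kernel_integral K A (\<mu> i) B (\<rho> j))" .
qed

lemma kernel_integrable_point_masses:
  assumes t: "t \<in> A" "s \<in> A"
    and K: "(\<lambda>(s, t). kernel_on K A A s t) \<in> borel_measurable (borel \<Otimes>\<^sub>M borel)"
  shows "kernel_integrable K A (point_mass t) A (point_mass s)"
  by (rule kernel_point_mass(1)[OF signed_measure_point_mass t(2) K
      signed_integral_point_mass(1)[OF t(1) kernel_section_measurable(2)[OF K t(2)]]])

lemma admissible_point_mass: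
  assumes t: "t \<in> A" and f: "set_borel_measurable borel A f"
    and K: "(\<lambda>(s, t). kernel_on K A A s t) \<in> borel_measurable (borel \<Otimes>\<^sub>M borel)"
  shows "admissible f K A (point_mass t)"
  unfolding admissible_def
proof (intro conjI)
  show "concentrated_on (point_mass t) A"
    using t by (auto simp: concentrated_on_def point_mass_def indicator_def)
qed (intro signed_measure_point_mass signed_integral_point_mass(1)[OF t f]
  kernel_integrable_point_masses[OF t t K])+

lemma admissible_restrict:
  assumes Q: "admissible f K A Q" and C: "C \<in> sets borel"
  shows "admissible f K A (\<lambda>B. Q (B \<inter> C))"
  unfolding admissible_def
proof (intro conjI)
  note D = admissibleD[OF Q]
  show "signed_measure (\<lambda>B. Q (B \<inter> C))" by (rule signed_measure_restrict[OF D(1) C])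
  show "concentrated_on (\<lambda>B. Q (B \<inter> C)) A"
    unfolding concentrated_on_def
  proof (intro ballI impI)
    fix B :: "'a set" assume "B \<in> sets borel" "B \<inter> A = {}"
    then have "B \<inter> C \<in> sets borel" "(B \<inter> C) \<inter> A = {}" using C by auto
    then show "Q (B \<inter> C) = 0" using D(2) by (simp add: concentrated_on_def)
  qed
  show "signed_integrable (\<lambda>B. Q (B \<inter> C)) A f" by (rule signed_integrable_restrict[OF D(1) C D(3)])
  show "kernel_integrable K A (\<lambda>B. Q (B \<inter> C)) A (\<lambda>B. Q (B \<inter> C))"
    using kernel_restrict(1)[OF D(1,1), of "\<lambda>_. C" "\<lambda>_. C"] D(4) C by simp
qed

section \<open>Moments of the integral operator and the extremal property of the BLUE\<close>

locale field_integration = prob_space M for M :: "'w measure" +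
  fixes E :: "'a::topological_space set" and \<theta> :: "real ^ 'm" and f :: "'a \<Rightarrow> real ^ 'm"
    and K :: "'a \<Rightarrow> 'a \<Rightarrow> real" and y :: "'a \<Rightarrow> 'w \<Rightarrow> real" and J :: "('a set \<Rightarrow> real) \<Rightarrow> 'w \<Rightarrow> real"
  assumes integral_operator: "stochastic_integral M E \<theta> f K y J"
    and kernel_symmetric: "\<And>s t. s \<in> E \<Longrightarrow> t \<in> E \<Longrightarrow> K s t = K t s"
begin

lemma square_integrable_J:
  "admissible f K A Q \<Longrightarrow> A \<in> sets borel \<Longrightarrow> A \<subseteq> E \<Longrightarrow> square_integrable M (J Q)"
  using integral_operator by (auto simp: stochastic_integral_def square_integrable_def)

lemma expectation_J:
  "admissible f K A Q \<Longrightarrow> A \<in> sets borel \<Longrightarrow> A \<subseteq> E \<Longrightarrow> expectation (J Q) = \<theta> \<bullet> signed_integral Q A f"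
  using integral_operator by (auto simp: stochastic_integral_def)

lemma covariance_J:
  assumes "admissible f K A Q" "A \<in> sets borel" "A \<subseteq> E" "admissible f K B R" "B \<in> sets borel" "B \<subseteq> E"
    "kernel_integrable K A Q B R"
  shows "covariance M (J Q) (J R) = kernel_integral K A Q B R"
  using integral_operator assms unfolding stochastic_integral_def by blast

text \<open>If some component of the BLUE were correlated with \<open>J \<eta>\<close>, its
  regression on \<open>J \<eta>\<close> could be removed at no cost to unbiasedness, and the
  covariance matrix would become strictly smaller in the Loewner order.\<close>

lemma BLUE_orthogonal:
  assumes G: "is_BLUE M J f K T G" and T: "T \<in> sets borel" "T \<subseteq> E"
    and \<eta>: "admissible f K T \<eta>" "signed_integral \<eta> T f = 0"
    and K: "\<And>i. kernel_integrable K T (component G i) T \<eta>"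
  shows "kernel_integral K T (component G i) T \<eta> = 0"
proof -
  define g where "g i = kernel_integral K T (component G i) T \<eta>" for i
  define v where "v = kernel_integral K T \<eta> T \<eta>"
  have Ga: "admissible f K T (component G i)" for i
    using G by (simp add: is_BLUE_def estimator_measure_def)
  have GG: "kernel_integrable K T (component G i) T (component G j)" for i j
    using G by (simp add: is_BLUE_def estimator_measure_def)
  note GD = admissibleD[OF Ga] and \<eta>D = admissibleD[OF \<eta>(1)]
  have sw: "kernel_integrable K T \<eta> T (component G i)"
    "kernel_integral K T \<eta> T (component G i) = g i" for i
    using kernel_swap[OF GD(1) \<eta>D(1) kernel_symmetric K, of i] T by (auto simp: g_def)
  have v: "v = covariance M (J \<eta>) (J \<eta>)"
    unfolding v_def using covariance_J[OF \<eta>(1) T \<eta>(1) T \<eta>D(4)] by simp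
  have g: "g i = covariance M (J (component G i)) (J \<eta>)" for i
    unfolding g_def using covariance_J[OF Ga T \<eta>(1) T K] by simp
  \<comment> \<open>The regression coefficient divides by v, so degenerate \<eta> is treated apart;
    there Cauchy-Schwarz already gives the claim.\<close>
  consider "v = 0" | "0 < v" using covariance_nonneg[of "J \<eta>"] v by fastforce
  then show ?thesis
  proof cases
    case 1
    then show ?thesis
      using covariance_Cauchy_Schwarz[OF square_integrable_J[OF Ga T] square_integrable_J[OF \<eta>(1) T], of i] g v
      by (simp add: g_def)
  next
    case 2
    \<comment> \<open>\<open>g i / v\<close> is the regression coefficient of
      \<open>J (component G i)\<close> on \<open>J \<eta>\<close>. Writing H as a sum over
      \<open>bool\<close> makes the lemmas on finite sums of measures apply; its covariances then
      follow from the bilinearity of \<open>kernel_integral\<close>.\<close>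
    define H where "H A = (\<chi> i. G A $ i - g i / v * \<eta> A)" for A
    define \<mu> where "\<mu> i b = (if b then component G i else \<eta>)" for i and b :: bool
    define \<alpha> where "\<alpha> i b = (if b then 1 else - g i / v)" for i and b :: bool
    have comp: "component H i = (\<lambda>A. \<Sum>b\<in>UNIV. \<alpha> i b * \<mu> i b A)" for i
      by (simp add: H_def component_def \<mu>_def \<alpha>_def UNIV_bool)
    have \<mu>a: "admissible f K T (\<mu> i b)" for i b using Ga \<eta>(1) by (simp add: \<mu>_def)
    have \<mu>K: "kernel_integrable K T (\<mu> i b) T (\<mu> j b')" for i j b b'
      using GG K sw(1) \<eta>D(4) by (simp add: \<mu>_def)
    note bi = kernel_integral_sum[OF finite_class.finite_UNIV UNIV_not_empty finite_class.finite_UNIV UNIV_not_empty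
        admissibleD(1)[OF \<mu>a] admissibleD(1)[OF \<mu>a] \<mu>K]
    have Ha: "admissible f K T (component H i)" for i
      unfolding comp by (rule admissible_sum) (use \<mu>a \<mu>K in auto)
    have HH: "kernel_integrable K T (component H i) T (component H j)" for i j
      unfolding comp by (rule bi)
    have covH: "covariance M (J (component H i)) (J (component H j))
        = covariance M (J (component G i)) (J (component G j)) - g i * g j / v" for i j
    proof -
      have "covariance M (J (component H i)) (J (component H j)) = kernel_integral K T (component H i) T (component H j)"
        by (rule covariance_J[OF Ha T Ha T HH])
      also have "\<dots> = kernel_integral K T (component G i) T (component G j) - g i * g j / v"
        unfolding comp bi(2) using 2
        by (simp add: UNIV_bool \<alpha>_def \<mu>_def sw(2) g_def[symmetric] v_def[symmetric] field_simps)
      finally show ?thesis using covariance_J[OF Ga T Ga T GG] by simp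
    qed
    have "unbiased_estimator f T H"
    proof -
      have "signed_integral (component H j) T f = signed_integral (component G j) T f" for j
        unfolding comp
        by (subst signed_integral_sum(2)) (use admissibleD[OF \<mu>a] \<eta>(2) in \<open>auto simp: UNIV_bool \<alpha>_def \<mu>_def\<close>)
      moreover have "signed_integral (component G j) T (\<lambda>t. f t $ i) = signed_integral (component G j) T f $ i" for i j
        by (rule signed_integral_linear[OF GD(1) bounded_linear_vec_nth GD(3)])
      moreover have "signed_integral (component H j) T (\<lambda>t. f t $ i) = signed_integral (component H j) T f $ i" for i j
        by (rule signed_integral_linear[OF admissibleD(1)[OF Ha] bounded_linear_vec_nth admissibleD(3)[OF Ha]])
      ultimately show ?thesis
        using G by (simp add: is_BLUE_def unbiased_estimator_def)
    qed
    moreover have "estimator_measure f K T H"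
      using Ha HH by (simp add: estimator_measure_def)
    moreover have "loewner_le (covariance_matrix M (linear_estimator J H)) (covariance_matrix M (linear_estimator J G))"
      unfolding loewner_le_def
    proof
      fix x :: "real ^ 'm"
      \<comment> \<open>The two covariance matrices differ by the outer product of g with itself,
        divided by v, so the quadratic form is a square divided by v. This is what makes H
        comparable with \<open>G\<close>.\<close>
      have "x \<bullet> ((covariance_matrix M (linear_estimator J G) - covariance_matrix M (linear_estimator J H)) *v x)
          = (\<Sum>i\<in>UNIV. \<Sum>j\<in>UNIV. x $ i * (g i * g j / v * x $ j))"
        by (simp add: inner_vec_def matrix_vector_mult_def covariance_matrix_def linear_estimator_def covH sum_distrib_left)
      also have "\<dots> = (\<Sum>i\<in>UNIV. x $ i * g i) * (\<Sum>j\<in>UNIV. x $ j * g j) / v"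
        by (simp add: sum_product sum_divide_distrib mult_ac)
      also have "0 \<le> \<dots>" using 2 by simp
      finally show "0 \<le> x \<bullet> ((covariance_matrix M (linear_estimator J G) - covariance_matrix M (linear_estimator J H)) *v x)" .
    qed
    ultimately have "covariance_matrix M (linear_estimator J H) = covariance_matrix M (linear_estimator J G)"
      using G by (simp add: is_BLUE_def)
    then have "covariance_matrix M (linear_estimator J H) $ i $ i = covariance_matrix M (linear_estimator J G) $ i $ i"
      by simp
    then have "g i * g i / v = 0"
      by (simp add: covariance_matrix_def linear_estimator_def covH)
    then show ?thesis using 2 by (simp add: g_def)
  qed
qed

lemma BLUE_kernel_representation:
  assumes G: "is_BLUE M J f K T G" and T: "T \<in> sets borel" "T \<subseteq> E"
    and int: "\<And>s i. s \<in> T \<Longrightarrow> signed_integrable (component G i) T (\<lambda>t. K t s)"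
  obtains d where "\<And>s i. s \<in> T \<Longrightarrow> signed_integral (component G i) T (\<lambda>t. K t s) = d i \<bullet> f s"
proof -
  have Ga: "admissible f K T (component G i)" for i
    using G by (simp add: is_BLUE_def estimator_measure_def)
  note GD = admissibleD[OF Ga]
  have mf: "set_borel_measurable borel T f"
    by (rule signed_integrable_measurable[OF GD(3)])
  note mK = kernel_integrable_measurable[OF GD(4)]
  obtain B where B: "B \<subseteq> f ` T" "independent B" "f ` T \<subseteq> span B"
    using maximal_independent_subset[of "f ` T"] by blast
  have fin: "finite B" using B(2) by (rule independent_imp_finite)
  define p where "p = inv_into T f"
  have p: "p b \<in> T" "f (p b) = b" if "b \<in> B" for b
    using B(1) that by (auto simp: p_def inv_into_into f_inv_into_f)
  have "\<exists>d. \<forall>s\<in>T. signed_integral (component G i) T (\<lambda>t. K t s) = d \<bullet> f s" for i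
  proof -
    define k where "k s = signed_integral (component G i) T (\<lambda>t. K t s)" for s
    obtain L where L: "linear L" "\<And>b. b \<in> B \<Longrightarrow> L b = k (p b)"
      using linear_independent_extend[OF B(2), of "\<lambda>b. k (p b)"] by blast
    have "k s = L (f s)" if s: "s \<in> T" for s
    proof -
      have "f s \<in> span B" using B(3) s by auto
      then obtain r where r: "f s = (\<Sum>b\<in>B. r b *\<^sub>R b)"
        by (auto simp: span_finite[OF fin])
      \<comment> \<open>\<open>None\<close> stands for s and \<open>Some b\<close> for the basis
        point \<open>p b\<close>. Indexing by options instead of points keeps the weights apart when
        s is itself a basis point.\<close>
      define I where "I = insert None (Some ` B)"
      define q where "q = case_option s p"
      define \<beta> where "\<beta> = case_option 1 (\<lambda>b. - r b)"
      define \<eta> where "\<eta> A = (\<Sum>i\<in>I. \<beta> i * point_mass (q i) A)" for A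
      have I: "finite I" "I \<noteq> {}" using fin by (auto simp: I_def)
      have q: "q i \<in> T" if "i \<in> I" for i using that s p by (auto simp: I_def q_def)
      have sumI: "(\<Sum>i\<in>I. F i) = F None + (\<Sum>b\<in>B. F (Some b))" for F :: "_ \<Rightarrow> 'z::comm_monoid_add"
        unfolding I_def using fin by (subst sum.insert) (auto simp: sum.reindex)
      have a: "admissible f K T \<eta>"
        unfolding \<eta>_def[abs_def]
        by (rule admissible_sum[OF I admissible_point_mass[OF q mf mK] kernel_integrable_point_masses[OF q q mK]])
      have "signed_integral \<eta> T f = (\<Sum>i\<in>I. \<beta> i *\<^sub>R f (q i))"
        unfolding \<eta>_def[abs_def]
        using signed_integral_sum(2)[OF I signed_measure_point_mass signed_integral_point_mass(1)[OF q mf]]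
          signed_integral_point_mass(2)[OF q mf] by simp
      also have "\<dots> = f s - (\<Sum>b\<in>B. r b *\<^sub>R b)"
        by (simp add: sumI \<beta>_def q_def p(2) sum_negf)
      finally have z: "signed_integral \<eta> T f = 0" using r by simp
      note pk = kernel_point_mass[OF GD(1) q mK int[OF q]]
      have ki: "kernel_integrable K T (component G j) T \<eta>" for j
        unfolding \<eta>_def[abs_def] by (rule kernel_sum_right(1)[OF I GD(1) signed_measure_point_mass pk(1)])
      have "kernel_integral K T (component G i) T \<eta> = (\<Sum>j\<in>I. \<beta> j * k (q j))"
        unfolding \<eta>_def[abs_def] k_def
        using kernel_sum_right(2)[OF I GD(1) signed_measure_point_mass pk(1)] pk(2) by simp
      also have "\<dots> = k s - (\<Sum>b\<in>B. r b * k (p b))"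
        by (simp add: sumI \<beta>_def q_def sum_negf)
      finally have "k s = (\<Sum>b\<in>B. r b * k (p b))"
        using BLUE_orthogonal[OF G T a z ki, of i] by simp
      also have "\<dots> = L (f s)"
        unfolding r using L by (simp add: linear_sum linear_cmul)
      finally show ?thesis .
    qed
    moreover have "\<exists>d. \<forall>x. L x = d \<bullet> x"
    proof (intro exI allI)
      fix x
      show "L x = adjoint L 1 \<bullet> x"
        using adjoint_works[OF L(1), of x 1] by (simp add: inner_commute)
    qed
    ultimately show ?thesis by (auto simp: k_def)
  qed
  then have "\<exists>d. \<forall>i. \<forall>s\<in>T. signed_integral (component G i) T (\<lambda>t. K t s) = d i \<bullet> f s" by metis
  then show thesis using that by blast
qed

text \<open>The kernel need not be integrable with respect to the product of \<open>R\<close> and \<open>Q\<close>, so the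
  covariance of the two integrals is obtained by truncating \<open>R\<close> to the sets where the potential
  of the total variation of \<open>Q\<close> is bounded, which converges in mean square.\<close>

lemma covariance_J_potential:
  assumes T: "T \<in> sets borel" "T \<subseteq> E"
    and Q: "admissible f K T Q" "\<And>s. s \<in> T \<Longrightarrow> signed_integrable Q T (\<lambda>t. K t s)"
    and R: "admissible f K T R" "kernel_integrable K T R S \<nu>" and \<nu>: "signed_measure \<nu>"
    and pot: "\<And>s. s \<in> T \<Longrightarrow> signed_integral Q T (\<lambda>t. K t s) = signed_integral \<nu> S (K s) + l \<bullet> f s"
  shows "covariance M (J R) (J Q) = kernel_integral K T R S \<nu> + l \<bullet> signed_integral R T f"
proof -
  note RD = admissibleD[OF R(1)] and QD = admissibleD[OF Q(1)]
  have sym: "K s t = K t s" if "s \<in> T" "t \<in> T" for s t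
    using kernel_symmetric T that by auto
  have Q': "signed_integrable Q T (K s)" if s: "s \<in> T" for s
    using Q(2)[OF s] signed_integrable_cong[of T "K s" "\<lambda>t. K t s" Q] sym s by simp
  obtain C where C: "\<And>n. C n \<in> sets borel"
    and ev: "\<And>t. t \<in> T \<Longrightarrow> eventually (\<lambda>n. t \<in> C n) sequentially"
    and ki: "\<And>n. kernel_integrable K T (\<lambda>E. R (E \<inter> C n)) T Q"
    using kernel_truncation[OF RD(1) QD(1) kernel_integrable_measurable[OF RD(4)] Q'] by blast
  define Rn where "Rn n = (\<lambda>A. R (A \<inter> C n))" for n
  have Rn: "admissible f K T (Rn n)" for n
    unfolding Rn_def by (rule admissible_restrict[OF R(1) C])
  note RnD = admissibleD[OF Rn]
  have uni: "UNIV \<in> sets borel" "eventually (\<lambda>n. x \<in> UNIV) sequentially" for x :: 'a by auto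
  \<comment> \<open>Cutting both factors gives the variance of \<open>J (Rn n)\<close>, cutting one
    gives its covariance with \<open>J R\<close> and its pairing with \<nu>.\<close>
  note rest = kernel_restrict[where C=C and D=C, OF RD(1) RD(1) C C RD(4), folded Rn_def]
    and rest1 = kernel_restrict[where C=C and D="\<lambda>_. UNIV", OF RD(1) RD(1) C uni(1) RD(4), folded Rn_def, simplified]
    and rest\<nu> = kernel_restrict[where C=C and D="\<lambda>_. UNIV", OF RD(1) \<nu> C uni(1) R(2), folded Rn_def, simplified]
  have "covariance M (J (Rn n)) (J Q) = kernel_integral K T (Rn n) S \<nu> + l \<bullet> signed_integral (Rn n) T f" for n
  proof -
    have lf: "signed_integrable (Rn n) T (\<lambda>s. l \<bullet> f s)"
      "signed_integral (Rn n) T (\<lambda>s. l \<bullet> f s) = l \<bullet> signed_integral (Rn n) T f"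
      using signed_integral_linear[OF RnD(1) bounded_linear_inner_right RnD(3)] by auto
    obtain \<tau> h where rep: "represents \<tau> h (Rn n)" using signed_measure_representation[OF RnD(1)] .
    obtain \<sigma> k where rep': "represents \<sigma> k \<nu>" using signed_measure_representation[OF \<nu>] .
    have "covariance M (J (Rn n)) (J Q) = kernel_integral K T (Rn n) T Q"
      using ki by (intro covariance_J[OF Rn T Q(1) T]) (simp add: Rn_def)
    also have "\<dots> = signed_integral (Rn n) T (\<lambda>s. signed_integral \<nu> S (K s) + l \<bullet> f s)"
      unfolding kernel_integral_def
    proof (rule signed_integral_cong)
      fix s assume s: "s \<in> T"
      show "signed_integral Q T (K s) = signed_integral \<nu> S (K s) + l \<bullet> f s"
        using pot[OF s] signed_integral_cong[of T "K s" "\<lambda>t. K t s" Q] sym s by simp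
    qed
    also have "\<dots> = kernel_integral K T (Rn n) S \<nu> + l \<bullet> signed_integral (Rn n) T f"
      using signed_integral_add[OF RnD(1) kernel_integral_eq(1)[OF rep rep' rest\<nu>(1)[of n]] lf(1)] lf(2)
      by (simp add: kernel_integral_def)
    finally show ?thesis .
  qed
  moreover have "(\<lambda>n. kernel_integral K T (Rn n) S \<nu> + l \<bullet> signed_integral (Rn n) T f)
      \<longlonglongrightarrow> kernel_integral K T R S \<nu> + l \<bullet> signed_integral R T f"
    using rest\<nu>(2)[OF ev] signed_integral_restrict_tendsto[OF RD(1) C RD(3) ev]
    by (intro tendsto_intros) (auto simp: Rn_def)
  \<comment> \<open>Mean-square convergence involves only pairings of truncations of R with each
    other and with R, all controlled by admissibility of R; the double integral of K against R and Q
    is never formed.\<close>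
  moreover have "(\<lambda>n. covariance M (J (Rn n)) (J Q)) \<longlonglongrightarrow> covariance M (J R) (J Q)"
  proof (rule covariance_tendsto)
    show "square_integrable M (J R)" "square_integrable M (J Q)" "square_integrable M (J (Rn n))" for n
      using square_integrable_J T R(1) Q(1) Rn by auto
    show "(\<lambda>n. covariance M (J (Rn n)) (J (Rn n))) \<longlonglongrightarrow> covariance M (J R) (J R)"
      using rest(2)[OF ev ev] covariance_J[OF Rn T Rn T rest(1)] covariance_J[OF R(1) T R(1) T RD(4)]
      by simp
    show "(\<lambda>n. covariance M (J (Rn n)) (J R)) \<longlonglongrightarrow> covariance M (J R) (J R)"
      using rest1(2)[OF ev] covariance_J[OF Rn T R(1) T rest1(1)] covariance_J[OF R(1) T R(1) T RD(4)]
      by simp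
  qed
  ultimately show ?thesis
    using LIMSEQ_unique by simp
qed

end

section \<open>The BLUP measure and its mean squared error\<close>

theorem theorem2p2:
  fixes M :: "'w measure"
    and T S E :: "(real ^ 'd) set"
    and f :: "real ^ 'd \<Rightarrow> real ^ 'm"
    and \<theta> :: "real ^ 'm"
    and K :: "real ^ 'd \<Rightarrow> real ^ 'd \<Rightarrow> real"
    and \<epsilon> y :: "real ^ 'd \<Rightarrow> 'w \<Rightarrow> real"
    and J :: "((real ^ 'd) set \<Rightarrow> real) \<Rightarrow> 'w \<Rightarrow> real"
    and \<nu> \<zeta> Qstar :: "(real ^ 'd) set \<Rightarrow> real"
    and G :: "(real ^ 'd) set \<Rightarrow> real ^ 'm"
    and D :: "real ^ 'm ^ 'm"
    and c :: "real ^ 'm"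
  assumes "prob_space M"
    and "T \<in> sets borel"
    and "T \<union> S \<subseteq> E"
    and "centered_random_field M E \<epsilon> K"
    and "\<And>t \<omega>. t \<in> E \<Longrightarrow> y t \<omega> = \<theta> \<bullet> f t + \<epsilon> t \<omega>"
    and "stochastic_integral M E \<theta> f K y J"
    \<comment> \<open>standing assumptions on \<open>f\<close> and \<open>K\<close>\<close>
    and "bounded (f ` T)"
    and "set_integrable lborel T f"
    and "components_independent_on T f"
    and "strictly_positive_definite_on E K"
    \<comment> \<open>the measure defining \<open>Z = J \<nu>\<close>\<close>
    and "S = signed_support \<nu>"
    and "S - T \<noteq> {}"
    and "admissible f K S \<nu>"
    \<comment> \<open>the BLUE and its covariance matrix\<close>
    and "is_BLUE M J f K T G"
    and "D = covariance_matrix M (linear_estimator J G)"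
    \<comment> \<open>the measure \<open>\<zeta>\<close>\<close>
    and "admissible f K T \<zeta>"
    and "\<And>s. s \<in> T \<Longrightarrow>
           signed_integral \<zeta> T (\<lambda>t. K t s) = signed_integral \<nu> S (\<lambda>u. K s u)"
    \<comment> \<open>absolute convergence of the remaining integrals of \<open>K\<close> that occur\<close>
    and "\<And>s. s \<in> T \<Longrightarrow> signed_integrable \<zeta> T (\<lambda>t. K t s)"
    and "\<And>s. s \<in> T \<Longrightarrow> signed_integrable \<nu> S (\<lambda>u. K s u)"
    and "\<And>s i. s \<in> T \<Longrightarrow> signed_integrable (component G i) T (\<lambda>t. K t s)"
    and "kernel_integrable K T \<zeta> S \<nu>"
    and "\<And>i. kernel_integrable K T (component G i) S \<nu>"
    and "\<And>i. kernel_integrable K T \<zeta> T (component G i)"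
    and "c = signed_integral \<nu> S f - signed_integral \<zeta> T f"
    and "Qstar = (\<lambda>A. \<zeta> A + c \<bullet> G A)"
  shows "is_BLUP_measure M J f K T S \<nu> Qstar \<and>
    mse M (J \<nu>) (J Qstar) =
      kernel_integral K S \<nu> S \<nu> + c \<bullet> (D *v signed_integral \<nu> S f)
        - kernel_integral K T Qstar S \<nu>"
proof -
  interpret prob_space M by fact
  have T: "T \<in> sets borel" "T \<subseteq> E" and S: "S \<in> sets borel" "S \<subseteq> E"
    using assms(2,3,11) closed_signed_support[of \<nu>] by auto
  have sym: "K s t = K t s" if "s \<in> E" "t \<in> E" for s t
    using assms(4) that by (simp add: centered_random_field_def mult.commute)
  interpret field_integration M E \<theta> f K y J
    by unfold_locales (use assms(6) sym in auto)
  note \<nu> = assms(13) and G = assms(14) and \<zeta> = assms(16) and pot = assms(17)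
  have Ga: "admissible f K T (component G i)"
    and GG: "kernel_integrable K T (component G i) T (component G j)" for i j
    using G by (simp_all add: is_BLUE_def estimator_measure_def)
  note \<nu>D = admissibleD[OF \<nu>] and GD = admissibleD[OF Ga] and \<zeta>D = admissibleD[OF \<zeta>]
  have \<zeta>G: "kernel_integrable K T \<zeta> T (component G i)" for i by fact
  have G\<zeta>: "kernel_integrable K T (component G i) T \<zeta>" for i
    by (rule kernel_swap(1)[OF \<zeta>D(1) GD(1) sym \<zeta>G]) (use T in auto)
  obtain d where d: "\<And>s i. s \<in> T \<Longrightarrow> signed_integral (component G i) T (\<lambda>t. K t s) = d i \<bullet> f s"
    using BLUE_kernel_representation[OF G T assms(20)] by blast
  have Gf: "signed_integral (component G i) T f = axis i 1" for i
  proof -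
    have "signed_integral (component G i) T f $ k = signed_integral (component G i) T (\<lambda>t. f t $ k)" for k
      by (rule signed_integral_linear(2)[OF GD(1) bounded_linear_vec_nth GD(3), symmetric])
    moreover have "(\<chi> i j. signed_integral (component G j) T (\<lambda>t. f t $ i)) $ k $ i = (mat 1 :: real ^ 'm ^ 'm) $ k $ i" for k
      using G by (simp add: is_BLUE_def unbiased_estimator_def)
    ultimately show ?thesis by (simp add: vec_eq_iff mat_def axis_def)
  qed
  \<comment> \<open>Component j has potential \<open>d j \<bullet> f\<close> on \<open>T\<close>;
    integrating it against component i, whose integral of \<open>f\<close> is the i-th unit vector,
    picks out the i-th coordinate of \<open>d j\<close>.\<close>
  have D: "D $ i $ j = d j $ i" for i j
  proof -
    have "D $ i $ j = kernel_integral K T (component G i) T (component G j)"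
      using covariance_J[OF Ga T Ga T GG] assms(15) by (simp add: covariance_matrix_def linear_estimator_def)
    also have "\<dots> = signed_integral (component G i) T (\<lambda>t. d j \<bullet> f t)"
      unfolding kernel_integral_def
    proof (rule signed_integral_cong)
      fix t assume t: "t \<in> T"
      have "signed_integral (component G j) T (K t) = signed_integral (component G j) T (\<lambda>s. K s t)"
        using sym T t by (intro signed_integral_cong) auto
      then show "signed_integral (component G j) T (K t) = d j \<bullet> f t" using d[OF t] by simp
    qed
    also have "\<dots> = d j \<bullet> axis i 1"
      using signed_integral_linear(2)[OF GD(1) bounded_linear_inner_right GD(3)] Gf by simp
    finally show ?thesis by (simp add: inner_axis)
  qed
  have D_sym: "D $ i $ j = D $ j $ i" for i j
    using assms(15) by (simp add: covariance_matrix_def linear_estimator_def covariance_commute)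
  \<comment> \<open>The potential of the correction term built from c and \<open>G\<close> is
    \<open>l \<bullet> f\<close>. By the formula for the entries of \<open>D\<close>, l is
    \<open>D *v c\<close>; symmetry of the covariance matrix then moves \<open>D\<close> to the
    other factor.\<close>
  define l where "l = (\<Sum>i\<in>UNIV. c $ i *\<^sub>R d i)"
  have l: "l \<bullet> x = c \<bullet> (D *v x)" for x
  proof -
    have "d i \<bullet> x = (D *v x) $ i" for i
      by (simp add: inner_vec_def matrix_vector_mult_def D[symmetric] D_sym[of i])
    then show ?thesis by (simp add: l_def inner_sum_left inner_vec_def[of c])
  qed

  \<comment> \<open>\<open>Qstar\<close> becomes one finite sum over \<open>'m option\<close>:
    \<open>None\<close> carries \<zeta> with weight 1, \<open>Some i\<close> the i-th component of
    \<open>G\<close> with weight \<open>c $ i\<close>.\<close>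
  define \<mu> where "\<mu> = case_option \<zeta> (component G)"
  define a where "a = case_option 1 (($) c)"
  have Q: "Qstar = (\<lambda>A. \<Sum>i\<in>UNIV. a i * \<mu> i A)"
    by (simp add: assms(25) sum_UNIV_option a_def \<mu>_def inner_vec_def component_def)
  note ne = finite_class.finite_UNIV UNIV_not_empty
  have \<mu>: "admissible f K T (\<mu> i)" for i
    using \<zeta> Ga by (simp add: \<mu>_def split: option.split)
  note \<mu>D = admissibleD[OF \<mu>]
  have \<mu>\<mu>: "kernel_integrable K T (\<mu> i) T (\<mu> j)" for i j
    using \<zeta>D(4) \<zeta>G G\<zeta> GG by (simp add: \<mu>_def split: option.split)
  have \<mu>\<nu>: "kernel_integrable K T (\<mu> i) S \<nu>" for i
    using assms(21,22) by (simp add: \<mu>_def split: option.split)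
  have \<mu>s: "signed_integrable (\<mu> i) T (\<lambda>t. K t s)" if "s \<in> T" for i s
    using assms(18,20) that by (simp add: \<mu>_def split: option.split)
  have Qa: "admissible f K T Qstar"
    unfolding Q by (rule admissible_sum[OF ne \<mu> \<mu>\<mu>])
  note QD = admissibleD[OF Qa]
  have Q\<nu>: "kernel_integrable K T Qstar S \<nu>"
    unfolding Q by (rule kernel_sum_left(1)[OF ne \<mu>D(1) \<nu>D(1) \<mu>\<nu>])
  have Qs: "signed_integrable Qstar T (\<lambda>t. K t s)" if "s \<in> T" for s
    unfolding Q by (rule signed_integral_sum(1)[OF ne \<mu>D(1) \<mu>s[OF that]])
  have Qpot: "signed_integral Qstar T (\<lambda>t. K t s) = signed_integral \<nu> S (K s) + l \<bullet> f s" if s: "s \<in> T" for s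
  proof -
    have "signed_integral Qstar T (\<lambda>t. K t s) = (\<Sum>i\<in>UNIV. a i *\<^sub>R signed_integral (\<mu> i) T (\<lambda>t. K t s))"
      unfolding Q by (rule signed_integral_sum(2)[OF ne \<mu>D(1) \<mu>s[OF s]])
    then show ?thesis
      using pot[OF s] d[OF s] by (simp add: sum_UNIV_option a_def \<mu>_def l_def inner_sum_left)
  qed
  \<comment> \<open>c is the discrepancy that \<zeta> leaves in the unbiasedness condition; each
    component of \<open>G\<close> repairs one coordinate of it.\<close>
  have Qf: "signed_integral Qstar T f = signed_integral \<nu> S f"
  proof -
    have "signed_integral Qstar T f = (\<Sum>i\<in>UNIV. a i *\<^sub>R signed_integral (\<mu> i) T f)"
      unfolding Q by (rule signed_integral_sum(2)[OF ne \<mu>D(1,3)])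
    also have "\<dots> = signed_integral \<zeta> T f + c"
      by (simp add: sum_UNIV_option a_def \<mu>_def Gf vec_eq_iff axis_def if_distrib cong: if_cong)
    finally show ?thesis using assms(24) by simp
  qed

  \<comment> \<open>For unbiased R the term with \<open>f\<close> in the covariance of
    \<open>J R\<close> and \<open>J Qstar\<close> is this constant, independent of R. Hence the
    excess of the mean squared error of R over that of \<open>Qstar\<close> is the variance of
    \<open>J R\<close> - \<open>J Qstar\<close>.\<close>
  define b where "b = l \<bullet> signed_integral \<nu> S f"
  have mse: "mse M (J \<nu>) (J R) = covariance M (J \<nu>) (J \<nu>) - 2 * kernel_integral K T R S \<nu> + covariance M (J R) (J R)"
    and cov: "covariance M (J R) (J Qstar) = kernel_integral K T R S \<nu> + b"
    if "predictor_measure f K T S \<nu> R" "unbiased_predictor f T S \<nu> R" for R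
  proof -
    have R: "admissible f K T R" "kernel_integrable K T R S \<nu>" "signed_integral R T f = signed_integral \<nu> S f"
      using that by (auto simp: predictor_measure_def unbiased_predictor_def)
    have "mse M (J \<nu>) (J R) = covariance M (J \<nu>) (J \<nu>) - 2 * covariance M (J \<nu>) (J R) + covariance M (J R) (J R)"
      using square_integrable_J[OF R(1) T] square_integrable_J[OF \<nu> S]
        expectation_J[OF R(1) T] expectation_J[OF \<nu> S] R(3)
      by (intro mse_eq_covariance) auto
    also have "covariance M (J \<nu>) (J R) = kernel_integral K T R S \<nu>"
      using covariance_J[OF R(1) T \<nu> S R(2)] by (simp add: covariance_commute)
    finally show "mse M (J \<nu>) (J R) = covariance M (J \<nu>) (J \<nu>) - 2 * kernel_integral K T R S \<nu> + covariance M (J R) (J R)" .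
    show "covariance M (J R) (J Qstar) = kernel_integral K T R S \<nu> + b"
      using covariance_J_potential[OF T Qa Qs R(1,2) \<nu>D(1) Qpot] R(3) by (simp add: b_def)
  qed
  have Qp: "predictor_measure f K T S \<nu> Qstar" "unbiased_predictor f T S \<nu> Qstar"
    using Qa Q\<nu> Qf by (auto simp: predictor_measure_def unbiased_predictor_def)
  have "mse M (J \<nu>) (J Qstar) \<le> mse M (J \<nu>) (J R)"
    if R: "predictor_measure f K T S \<nu> R" "unbiased_predictor f T S \<nu> R" for R
  proof -
    have "square_integrable M (J R)" "square_integrable M (J Qstar)"
      using R(1) Qa square_integrable_J T by (auto simp: predictor_measure_def)
    from covariance_quadratic[OF this, of 1 "-1"]
      covariance_nonneg[of "\<lambda>\<omega>. 1 * J R \<omega> + (-1) * J Qstar \<omega>"]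
    have "0 \<le> covariance M (J R) (J R) - 2 * covariance M (J R) (J Qstar) + covariance M (J Qstar) (J Qstar)"
      by simp
    then show ?thesis
      using mse[OF R] cov[OF R] mse[OF Qp] cov[OF Qp] by simp
  qed
  \<comment> \<open>The rule \<open>cov\<close> for R = \<open>Qstar\<close> gives its variance as
    its pairing with \<nu> plus b, which cancels one of the two subtracted copies of that
    pairing.\<close>
  moreover have "mse M (J \<nu>) (J Qstar) = kernel_integral K S \<nu> S \<nu> + c \<bullet> (D *v signed_integral \<nu> S f)
      - kernel_integral K T Qstar S \<nu>"
    using mse[OF Qp] cov[OF Qp] covariance_J[OF \<nu> S \<nu> S \<nu>D(4)] l by (simp add: b_def)
  ultimately show ?thesis using Qp by (simp add: is_BLUP_measure_def)
qed

end
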